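(* If $G$ is a simple connected outerplanar graph with maximum degree $\Delta(G)\leq 4$, then $G$ has a cyclic interval $t$-coloring for some positive integer $t$.
   Context: A simple graph has no loops or multiple edges; outerplanar means it has a planar embedding with all vertices on the outer face. A proper $t$-edge coloring of $G$ is a map $\alpha:E(G)\to\{1,\dots,t\}$ with $\alpha(e)\neq\alpha(e')$ for adjacent edges $e,e'$; $S(v,\alpha)$ is the set of colors on edges incident to $v$. A proper $t$-edge coloring $\alpha$ is a cyclic interval $t$-coloring if for every vertex $v$, either $S(v,\alpha)$ or $\{1,\dots,t\}\setminus S(v,\alpha)$ is a set of consecutive integers. *)

theory Defs
  imports "HOL-Analysis.Analysis"
begin

(* A graph is given by its vertex set V and its edge set E; an edge is the two-element
   set of its endpoints, which excludes loops and multiple edges. *)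

definition simple_graph :: "'a set \<Rightarrow> 'a set set \<Rightarrow> bool" where
  "simple_graph V E \<longleftrightarrow> finite V \<and> V \<noteq> {} \<and> (\<forall>e\<in>E. e \<subseteq> V \<and> card e = 2)"

definition connected_graph :: "'a set \<Rightarrow> 'a set set \<Rightarrow> bool" where
  "connected_graph V E \<longleftrightarrow> (\<forall>u\<in>V. \<forall>v\<in>V. (u, v) \<in> {(x, y). {x, y} \<in> E}\<^sup>*)"

definition incident_edges :: "'a set set \<Rightarrow> 'a \<Rightarrow> 'a set set" where
  "incident_edges E v = {e \<in> E. v \<in> e}"

definition max_degree :: "'a set \<Rightarrow> 'a set set \<Rightarrow> nat" where
  "max_degree V E = Max ((\<lambda>v. card (incident_edges E v)) ` V)"

(* The vertex v is drawn as the point p v, the edge e as the Jordan arc g e joining the points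
   of its endpoints. Arcs pass through no other vertex points and pairwise meet only at the
   points of common endpoints. *)

definition planar_embedding ::
    "'a set \<Rightarrow> 'a set set \<Rightarrow> ('a \<Rightarrow> complex) \<Rightarrow> ('a set \<Rightarrow> real \<Rightarrow> complex) \<Rightarrow> bool" where
  "planar_embedding V E p g \<longleftrightarrow>
     inj_on p V \<and>
     (\<forall>e\<in>E. arc (g e) \<and> {pathstart (g e), pathfinish (g e)} = p ` e \<and>
            path_image (g e) \<inter> p ` V = p ` e) \<and>
     (\<forall>e\<in>E. \<forall>e'\<in>E. e \<noteq> e' \<longrightarrow> path_image (g e) \<inter> path_image (g e') = p ` (e \<inter> e'))"

definition drawing ::
    "'a set \<Rightarrow> 'a set set \<Rightarrow> ('a \<Rightarrow> complex) \<Rightarrow> ('a set \<Rightarrow> real \<Rightarrow> complex) \<Rightarrow> complex set" where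
  "drawing V E p g = p ` V \<union> (\<Union>e\<in>E. path_image (g e))"

(* For a finite graph the drawing is compact, so its complement has exactly one unbounded
   component, the outer face, and this is the library's "outside" of the drawing. A vertex
   lies on a face if its point lies on the boundary of the face. *)

definition outerplanar :: "'a set \<Rightarrow> 'a set set \<Rightarrow> bool" where
  "outerplanar V E \<longleftrightarrow>
     (\<exists>p g. planar_embedding V E p g \<and> (\<forall>v\<in>V. p v \<in> frontier (outside (drawing V E p g))))"

definition proper_edge_coloring :: "'a set set \<Rightarrow> nat \<Rightarrow> ('a set \<Rightarrow> nat) \<Rightarrow> bool" where
  "proper_edge_coloring E t \<alpha> \<longleftrightarrow>
     (\<forall>e\<in>E. \<alpha> e \<in> {1..t}) \<and>
     (\<forall>e\<in>E. \<forall>e'\<in>E. e \<noteq> e' \<and> e \<inter> e' \<noteq> {} \<longrightarrow> \<alpha> e \<noteq> \<alpha> e')"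

definition spectrum :: "'a set set \<Rightarrow> ('a set \<Rightarrow> nat) \<Rightarrow> 'a \<Rightarrow> nat set" where
  "spectrum E \<alpha> v = \<alpha> ` incident_edges E v"

(* The empty set counts as consecutive: if S(v) = {1..t}, its complement is empty. *)

definition consecutive :: "nat set \<Rightarrow> bool" where
  "consecutive A \<longleftrightarrow> (\<exists>a b. A = {a..b})"

definition cyclic_interval_coloring ::
    "'a set \<Rightarrow> 'a set set \<Rightarrow> nat \<Rightarrow> ('a set \<Rightarrow> nat) \<Rightarrow> bool" where
  "cyclic_interval_coloring V E t \<alpha> \<longleftrightarrow>
     proper_edge_coloring E t \<alpha> \<and>
     (\<forall>v\<in>V. consecutive (spectrum E \<alpha> v) \<or> consecutive ({1..t} - spectrum E \<alpha> v))"

end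

theory Submission
  imports Defs
begin

text \<open>Apart from the triangle, which is coloured with three distinct colours, the colours are the
  residues modulo 5: a vertex of degree 0, 1 or 4 then imposes no condition beyond properness, and
  the colours at a vertex of degree 2 or 3 must be cyclically consecutive. (Four colours do not
  suffice: take a triangle with a pendant triangle at each vertex.)

  The Jordan curve theorem and Janiszewski's theorem show that a drawing with all vertices on the
  outer face contains neither a theta graph with a vertex inside each of its three paths nor a cycle
  with two crossing chords. Hence every part of the graph with at least four vertices and no cut
  vertex is a Hamiltonian cycle with noncrossing chords, and the vertices can be ordered on a line
  such that no two edges, drawn as half circles above it, cross. Cutting at the last neighbour of
  the first vertex builds the graph from edgeless pairs by two operations on pieces with two
  terminals: joining two pieces at a terminal, and adding the edge between the terminals. For given
  degrees of the terminals there is a finite list of relations such that every piece realizes all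
  pairs of terminal colour sets of at least one of them; that the lists are closed under both
  operations is a finite check.\<close>

section \<open>Theta graphs in the plane\<close>

text \<open>While further edges may still arrive at a terminal, its colour set need not be a cyclic
  interval. The interval condition is imposed when a series join turns the vertex into an inner one,
  and on the two remaining terminals at the very end. A piece therefore has to be summarized by the
  pairs of terminal sets it admits. Terminal degrees alone do not determine these pairs: for paths
  of two, three and four edges the end colours differ by 1, by 0 or 2, and by 1 or 2 (up to sign).
  Hence the tables list alternatives, each rich enough to be carried through both operations and,
  apart from the triangle, to contain a pair of cyclic intervals once the piece is the whole graph.
  Disconnected pieces cannot be avoided, because the edge between the terminals may be the only link
  between its two sides. Pieces with more than two components must not arise, since no later step
  would reconnect them; connectedness of the whole graph excludes them.\<close>

text \<open>Arcs are handled as point sets rather than parametrized paths, so that orientation can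
  be ignored and concatenation is a union.\<close>

definition arc_between :: "complex set \<Rightarrow> complex \<Rightarrow> complex \<Rightarrow> bool" where
  "arc_between A a b \<longleftrightarrow> (\<exists>h. arc h \<and> pathstart h = a \<and> pathfinish h = b \<and> path_image h = A)"

lemma arc_betweenE:
  assumes "arc_between A a b"
  obtains h where "arc h" "pathstart h = a" "pathfinish h = b" "path_image h = A"
  using assms unfolding arc_between_def by blast

lemma arc_between_ends: "arc_between A a b \<Longrightarrow> a \<in> A \<and> b \<in> A \<and> a \<noteq> b"
  unfolding arc_between_def using arc_distinct_ends by fastforce

lemma arc_between_commute: "arc_between A a b \<Longrightarrow> arc_between A b a"
  unfolding arc_between_def
  by (metis arc_reversepath path_image_reversepath pathfinish_reversepath pathstart_reversepath)

lemma arc_between_Un: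
  assumes "arc_between A a b" "arc_between B b c" "A \<inter> B = {b}"
  shows "arc_between (A \<union> B) a c"
proof -
  obtain h where h: "arc h" "pathstart h = a" "pathfinish h = b" "path_image h = A"
    using assms(1) by (rule arc_betweenE)
  obtain k where k: "arc k" "pathstart k = b" "pathfinish k = c" "path_image k = B"
    using assms(2) by (rule arc_betweenE)
  have "arc (h +++ k)"
    using h k assms(3) by (intro arc_join) auto
  then show ?thesis
    unfolding arc_between_def using h k
    by (metis path_image_join pathfinish_join pathstart_join)
qed

lemma arc_between_compact: "arc_between A a b \<Longrightarrow> compact A"
  unfolding arc_between_def using compact_arc_image by blast

lemma arc_between_connected_interior: "arc_between A a b \<Longrightarrow> connected (A - {a, b})"
  unfolding arc_between_def using connected_simple_path_endless arc_imp_simple_path by blast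

lemma arc_between_connected_Diff:
  assumes "arc_between A a b"
  shows "connected (A - {a})"
proof -
  obtain h where h: "arc h" "pathstart h = a" "pathfinish h = b" "path_image h = A"
    using assms by (rule arc_betweenE)
  have "A - {a} = h ` {0<..1}"
  proof -
    have "inj_on h {0..1}" "A = h ` {0..1}" "a = h 0"
      using h by (auto simp: arc_def path_image_def pathstart_def)
    then have "A - {a} = h ` ({0..1} - {0})"
      by (simp add: inj_on_image_set_diff[of h "{0..1}"])
    moreover have "{0..1} - {0} = {0<..1::real}"
      by auto
    ultimately show ?thesis
      by simp
  qed
  moreover have "continuous_on {0<..1} h"
    using h(1) unfolding arc_def path_def by (auto intro: continuous_on_subset)
  ultimately show ?thesis
    by (metis connected_Ioc connected_continuous_image)
qed

lemma arc_between_interior_nonempty: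
  assumes "arc_between A a b"
  shows "A - {a, b} \<noteq> {}"
  using assms unfolding arc_between_def
  using arc_imp_simple_path nonempty_simple_path_endless by blast

lemma Jordan_arcs:
  assumes "arc_between A a b" "arc_between B a b" "A \<inter> B = {a, b}"
  shows "inside (A \<union> B) \<noteq> {}" "open (inside (A \<union> B))" "connected (inside (A \<union> B))"
    "frontier (inside (A \<union> B)) = A \<union> B"
proof -
  obtain h where h: "arc h" "pathstart h = a" "pathfinish h = b" "path_image h = A"
    using assms(1) by (rule arc_betweenE)
  obtain k where k: "arc k" "pathstart k = b" "pathfinish k = a" "path_image k = B"
    using arc_between_commute[OF assms(2)] by (rule arc_betweenE)
  have c: "simple_path (h +++ k)" "pathfinish (h +++ k) = pathstart (h +++ k)"
    "path_image (h +++ k) = A \<union> B"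
    using h k assms(3) by (auto intro!: simple_path_join_loop simp: path_image_join)
  show "inside (A \<union> B) \<noteq> {}" "open (inside (A \<union> B))" "connected (inside (A \<union> B))"
    "frontier (inside (A \<union> B)) = A \<union> B"
    using Jordan_inside_outside[OF c(1,2)] c(3) by auto
qed

text \<open>The open arc is connected and misses \<open>K\<close>, which contains the frontier of
  \<open>inside K\<close>; having entered the inside, it cannot leave it.\<close>

lemma interior_subset_inside:
  assumes C: "arc_between C a b" and "compact K" "C \<inter> K \<subseteq> {a, b}" "a \<in> K" "b \<in> K"
    and "C \<inter> inside K \<noteq> {}"
  shows "C - {a, b} \<subseteq> inside K"
proof (rule ccontr)
  assume "\<not> C - {a, b} \<subseteq> inside K"
  moreover have "(C - {a, b}) \<inter> inside K \<noteq> {}"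
    using assms(4-6) inside_no_overlap[of K] by blast
  ultimately have "(C - {a, b}) \<inter> frontier (inside K) \<noteq> {}"
    using connected_Int_frontier[OF arc_between_connected_interior[OF C]] by blast
  moreover have "frontier (inside K) \<subseteq> K"
    using assms(2) by (simp add: frontier_inside_subset compact_imp_closed)
  ultimately show False
    using assms(3) by blast
qed

text \<open>If no arc enters the inside of the other two, then each of the three insides is a component
  of the complement of the theta graph. By Janiszewski's theorem a point inside one of the three
  closed curves is inside a second one, so two of these components coincide, although their
  frontiers differ.\<close>

lemma theta_inside:
  assumes A: "arc_between A a b" and B: "arc_between B a b" and C: "arc_between C a b"
    and AB: "A \<inter> B = {a, b}" and AC: "A \<inter> C = {a, b}" and BC: "B \<inter> C = {a, b}"
  shows "C \<inter> inside (A \<union> B) \<noteq> {} \<or> B \<inter> inside (A \<union> C) \<noteq> {} \<or> A \<inter> inside (B \<union> C) \<noteq> {}"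
proof (rule ccontr)
  assume "\<not> ?thesis"
  then have no: "C \<inter> inside (A \<union> B) = {}" "B \<inter> inside (A \<union> C) = {}" "A \<inter> inside (B \<union> C) = {}"
    by auto
  have cpt: "compact A" "compact B" "compact C"
    using A B C arc_between_compact by auto
  have disj: "inside (A \<union> B) \<inter> inside (P \<union> C) = {}"
    if P: "arc_between P a b" "P \<inter> C = {a, b}" "P \<subseteq> A \<union> B" and noP: "(A \<union> B) \<inter> inside (P \<union> C) = {}" for P
  proof (rule ccontr)
    assume meet: "inside (A \<union> B) \<inter> inside (P \<union> C) \<noteq> {}"
    note jP = Jordan_arcs[OF P(1) C P(2)]
    note jB = Jordan_arcs[OF A B AB]
    have "inside (A \<union> B) \<inter> (P \<union> C) = {}"
      using no P(3) inside_no_overlap[of "A \<union> B"] by blast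
    then have "inside (A \<union> B) \<subseteq> inside (P \<union> C)"
      using connected_Int_frontier[OF jB(3) meet] jP(4) by blast
    moreover have "inside (P \<union> C) \<subseteq> inside (A \<union> B)"
      using connected_Int_frontier[OF jP(3), of "inside (A \<union> B)"] meet jB(4) noP by blast
    ultimately have "A \<union> B = P \<union> C"
      using jP(4) jB(4) by auto
    moreover obtain z where "z \<in> C" "z \<noteq> a" "z \<noteq> b"
      using arc_between_interior_nonempty[OF C] by blast
    ultimately show False
      using AC BC by blast
  qed
  obtain x where x: "x \<in> inside (A \<union> B)"
    using Jordan_arcs(1)[OF A B AB] by blast
  have "(A \<union> B) \<inter> inside (A \<union> C) = {}" "(A \<union> B) \<inter> inside (B \<union> C) = {}"
    using no inside_no_overlap[of "A \<union> C"] inside_no_overlap[of "B \<union> C"] by blast+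
  then have "inside (A \<union> B) \<inter> inside (A \<union> C) = {}" "inside (A \<union> B) \<inter> inside (B \<union> C) = {}"
    using disj[OF A AC] disj[OF B BC] by auto
  then have x': "x \<notin> inside (A \<union> C)" "x \<notin> inside (B \<union> C)"
    using x by auto
  have "x \<notin> A \<union> B" "x \<notin> C"
    using x no inside_no_overlap[of "A \<union> B"] by blast+
  then have xo: "x \<in> outside (A \<union> C)" "x \<in> outside (B \<union> C)"
    using x' by (auto simp: outside_inside)
  obtain y where y: "y \<in> outside (A \<union> B \<union> C)"
    using outside_bounded_nonempty[of "A \<union> B \<union> C"] cpt by (auto simp: compact_imp_bounded)
  have "outside (A \<union> B \<union> C) \<subseteq> outside S" if "S \<subseteq> A \<union> B \<union> C" for S
    using outside_mono that by blast
  from this[of "A \<union> B"] this[of "A \<union> C"] this[of "B \<union> C"]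
  have yo: "y \<in> outside (A \<union> B)" "y \<in> outside (A \<union> C)" "y \<in> outside (B \<union> C)"
    using y by auto
  have cc: "connected_component (- S) x y" if "compact S" "x \<in> outside S" "y \<in> outside S" for S
  proof -
    have "connected (outside S)"
      using connected_outside[of S] that(1) by (simp add: compact_imp_bounded)
    moreover have "outside S \<subseteq> - S"
      using outside_no_overlap[of S] by blast
    ultimately show ?thesis
      unfolding connected_component_def using that by blast
  qed
  \<comment> \<open>The two closed curves meet exactly in the arc \<open>C\<close>, and
    Janiszewski's theorem needs this intersection to be connected; \<open>x\<close> and
    \<open>y\<close> lie outside both curves.\<close>
  have "connected ((A \<union> C) \<inter> (B \<union> C))"
  proof -
    have "(A \<union> C) \<inter> (B \<union> C) = C"
      using AB arc_between_ends[OF C] by (simp add: Un_Int_distrib2[symmetric] insert_absorb)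
    then show ?thesis
      using C unfolding arc_between_def using connected_arc_image by metis
  qed
  then have "connected_component (- ((A \<union> C) \<union> (B \<union> C))) x y"
    using cpt xo yo by (intro Janiszewski cc) (auto intro: compact_imp_closed)
  then have "connected_component (- (A \<union> B)) x y"
    by (rule connected_component_of_subset) auto
  then show False
    using inside_same_component[OF _ x] yo(1) inside_Int_outside[of "A \<union> B"] by blast
qed

section \<open>Configurations that points on the outer face exclude\<close>

text \<open>The open set \<open>inside K\<close> would be a neighbourhood of \<open>x\<close> and so
  meet \<open>outside D\<close>, which is contained in \<open>outside K\<close>.\<close>

lemma outer_point_notin_inside:
  fixes x :: complex
  assumes "x \<in> frontier (outside D)" "compact K" "K \<subseteq> D"
  shows "x \<notin> inside K"
proof
  assume "x \<in> inside K"
  moreover have "open (inside K)"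
    by (intro open_inside compact_imp_closed assms)
  moreover have "x \<in> closure (outside D)"
    using assms(1) by (simp add: frontier_def)
  ultimately have "inside K \<inter> outside D \<noteq> {}"
    using open_Int_closure_eq_empty[of "inside K" "outside D"] by blast
  then show False
    using outside_mono[OF assms(3)] inside_Int_outside[of K] by blast
qed

text \<open>By \<open>theta_inside\<close> some arc enters the inside of the other two; its whole
  interior then lies there, including its marked outer point.\<close>

lemma no_outer_theta:
  assumes A: "arc_between A a b" and B: "arc_between B a b" and C: "arc_between C a b"
    and AB: "A \<inter> B = {a, b}" and AC: "A \<inter> C = {a, b}" and BC: "B \<inter> C = {a, b}"
    and sub: "A \<union> B \<union> C \<subseteq> D"
    and pts: "x \<in> A - {a, b}" "y \<in> B - {a, b}" "z \<in> C - {a, b}"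
    and outer: "{x, y, z} \<subseteq> frontier (outside D)"
  shows False
proof -
  have cpt: "compact A" "compact B" "compact C"
    using A B C arc_between_compact by auto
  have ends: "a \<in> A" "b \<in> A" "a \<in> B" "b \<in> B"
    using A B arc_between_ends by auto
  have "x \<notin> inside (B \<union> C)" "y \<notin> inside (A \<union> C)" "z \<notin> inside (A \<union> B)"
    by (rule outer_point_notin_inside[of _ D]; use outer sub cpt in auto)+
  moreover have "C - {a, b} \<subseteq> inside (A \<union> B)" if "C \<inter> inside (A \<union> B) \<noteq> {}"
    using cpt ends AC BC that by (intro interior_subset_inside[OF C]) auto
  moreover have "B - {a, b} \<subseteq> inside (A \<union> C)" if "B \<inter> inside (A \<union> C) \<noteq> {}"
    using cpt ends AB BC that by (intro interior_subset_inside[OF B]) auto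
  moreover have "A - {a, b} \<subseteq> inside (B \<union> C)" if "A \<inter> inside (B \<union> C) \<noteq> {}"
    using cpt ends AC AB that by (intro interior_subset_inside[OF A]) auto
  ultimately show False
    using theta_inside[OF A B C AB AC BC] pts by blast
qed

text \<open>The marked points refute two of the three alternatives of \<open>theta_inside\<close>.
  The arc \<open>C\<close> carries no marked point, so the third one remains: a chord of a cycle
  runs inside the cycle.\<close>

lemma outer_chord_inside:
  assumes A: "arc_between A a c" and B: "arc_between B a c" and C: "arc_between C a c"
    and AB: "A \<inter> B = {a, c}" and AC: "A \<inter> C = {a, c}" and BC: "B \<inter> C = {a, c}"
    and sub: "A \<union> B \<union> C \<subseteq> D"
    and pts: "x \<in> A - {a, c}" "y \<in> B - {a, c}"
    and outer: "{x, y} \<subseteq> frontier (outside D)"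
  shows "C \<inter> inside (A \<union> B) \<noteq> {}"
proof -
  have cpt: "compact A" "compact B" "compact C"
    using A B C arc_between_compact by auto
  have ends: "a \<in> A" "c \<in> A" "a \<in> B" "c \<in> B"
    using A B arc_between_ends by auto
  have "x \<notin> inside (B \<union> C)" "y \<notin> inside (A \<union> C)"
    by (rule outer_point_notin_inside[of _ D]; use outer sub cpt in auto)+
  moreover have "B - {a, c} \<subseteq> inside (A \<union> C)" if "B \<inter> inside (A \<union> C) \<noteq> {}"
    using cpt ends AB BC that by (intro interior_subset_inside[OF B]) auto
  moreover have "A - {a, c} \<subseteq> inside (B \<union> C)" if "A \<inter> inside (B \<union> C) \<noteq> {}"
    using cpt ends AC AB that by (intro interior_subset_inside[OF A]) auto
  ultimately show ?thesis
    using theta_inside[OF A B C AB AC BC] pts by blast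
qed

text \<open>Both chords run inside the cycle, and the first splits the inside into two halves. The
  second avoids the first, so it stays in one half; but one of its ends is an outer point that is
  not on the boundary of that half.\<close>

lemma no_outer_crossing_chords:
  assumes Aab: "arc_between Aab a b" and Abc: "arc_between Abc b c"
    and Acd: "arc_between Acd c d" and Ada: "arc_between Ada d a"
    and Cac: "arc_between Cac a c" and Cbd: "arc_between Cbd b d"
    and i1: "Aab \<inter> Abc = {b}" and i2: "Abc \<inter> Acd = {c}" and i3: "Acd \<inter> Ada = {d}"
    and i4: "Ada \<inter> Aab = {a}" and i5: "Aab \<inter> Acd = {}" and i6: "Abc \<inter> Ada = {}"
    and k1: "Cac \<inter> (Aab \<union> Abc \<union> Acd \<union> Ada) = {a, c}"
    and k2: "Cbd \<inter> (Aab \<union> Abc \<union> Acd \<union> Ada) = {b, d}"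
    and k3: "Cac \<inter> Cbd = {}"
    and sub: "Aab \<union> Abc \<union> Acd \<union> Ada \<union> Cac \<union> Cbd \<subseteq> D"
    and outer: "{a, b, c, d} \<subseteq> frontier (outside D)"
  shows False
proof -
  note arcs = Aab Abc Acd Ada Cac Cbd
  define J where "J = Aab \<union> Abc \<union> Acd \<union> Ada"
  have ends: "a \<in> Aab" "b \<in> Aab" "b \<in> Abc" "c \<in> Abc" "c \<in> Acd" "d \<in> Acd" "d \<in> Ada" "a \<in> Ada"
    "a \<in> Cac" "c \<in> Cac" "b \<in> Cbd" "d \<in> Cbd"
    and ne: "a \<noteq> b" "b \<noteq> c" "c \<noteq> d" "d \<noteq> a" "a \<noteq> c" "b \<noteq> d"
    using arcs arc_between_ends by auto
  have cpt: "compact Aab" "compact Abc" "compact Acd" "compact Ada" "compact Cac" "compact Cbd"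
    using arcs arc_between_compact by auto
  then have cJ: "compact J"
    unfolding J_def by (intro compact_Un)
  define L where "L = Aab \<union> Abc"
  define R where "R = Acd \<union> Ada"
  have L: "arc_between L a c" and R: "arc_between R a c"
    using arc_between_Un[OF Aab Abc i1] arc_between_Un[OF Acd Ada i3] arc_between_commute
    unfolding L_def R_def by auto
  have LR: "L \<inter> R = {a, c}" "L \<inter> Cac = {a, c}" "R \<inter> Cac = {a, c}" "L \<union> R = J"
  proof -
    show "L \<inter> R = {a, c}"
      unfolding L_def R_def using i2 i4 i5 i6 by (simp add: Int_Un_distrib Int_Un_distrib2 Int_commute)
    show "L \<inter> Cac = {a, c}" "R \<inter> Cac = {a, c}"
      unfolding L_def R_def using k1 ends by (simp_all add: set_eq_iff) metis+
    show "L \<union> R = J"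
      unfolding L_def R_def J_def by (simp add: Un_assoc)
  qed
  have bd: "b \<in> L" "d \<in> R" "b \<notin> R" "d \<notin> L" "b \<notin> Cac" "d \<notin> Cac"
  proof -
    show "b \<in> L" "d \<in> R"
      unfolding L_def R_def using ends by auto
    show "b \<notin> R" "d \<notin> L" "b \<notin> Cac" "d \<notin> Cac"
      using LR(2,3) k3 ends ne unfolding L_def R_def
      using i1 i3 i5 i6 by (metis Int_iff Un_iff empty_iff singletonD)+
  qed
  have Cac_in: "Cac \<inter> inside (L \<union> R) \<noteq> {}"
  proof (rule outer_chord_inside[OF L R Cac LR(1-3)])
    show "L \<union> R \<union> Cac \<subseteq> D"
      using sub unfolding L_def R_def by simp
    show "b \<in> L - {a, c}" "d \<in> R - {a, c}"
      using bd ne by auto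
    show "{b, d} \<subseteq> frontier (outside D)"
      using outer by simp
  qed
  define S where "S = Abc \<union> Acd"
  define T where "T = Aab \<union> Ada"
  have S: "arc_between S b d"
    using arc_between_Un[OF Abc Acd i2] unfolding S_def .
  have T: "arc_between T b d"
    using arc_between_Un[OF Ada Aab i4] arc_between_commute unfolding T_def by (metis Un_commute)
  have ST: "S \<inter> T = {b, d}" "S \<inter> Cbd = {b, d}" "T \<inter> Cbd = {b, d}" "S \<union> T = J"
  proof -
    show "S \<inter> T = {b, d}"
      unfolding S_def T_def using i1 i3 i5 i6 by (simp add: Int_Un_distrib Int_Un_distrib2 Int_commute insert_commute)
    show "S \<inter> Cbd = {b, d}" "T \<inter> Cbd = {b, d}"
      unfolding S_def T_def using k2 ends by (simp_all add: set_eq_iff) metis+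
    show "S \<union> T = J"
      unfolding S_def T_def J_def by (simp add: Un_ac)
  qed
  have ac: "c \<in> S" "a \<in> T"
    unfolding S_def T_def using ends by blast+
  have "Cbd \<inter> inside (S \<union> T) \<noteq> {}"
  proof (rule outer_chord_inside[OF S T Cbd ST(1-3)])
    show "S \<union> T \<union> Cbd \<subseteq> D"
      using sub unfolding S_def T_def by simp
    show "c \<in> S - {b, d}" "a \<in> T - {b, d}"
      using ac ne by auto
    show "{c, a} \<subseteq> frontier (outside D)"
      using outer by simp
  qed
  then have sub_in: "Cbd - {b, d} \<subseteq> inside J"
    using ST(4) cJ k2 ends unfolding J_def by (intro interior_subset_inside[OF Cbd]) auto
  obtain hL hR hC where h:
    "arc hL" "pathstart hL = a" "pathfinish hL = c" "path_image hL = L"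
    "arc hR" "pathstart hR = a" "pathfinish hR = c" "path_image hR = R"
    "arc hC" "pathstart hC = a" "pathfinish hC = c" "path_image hC = Cac"
    using L R Cac unfolding arc_between_def by blast
  have split: "inside (L \<union> Cac) \<union> inside (R \<union> Cac) \<union> (Cac - {a, c}) = inside J"
    using split_inside_simple_closed_curve[of hL a c hR hC] h LR Cac_in ne arc_imp_simple_path by metis
  \<comment> \<open>\<open>P\<close> is the part of the cycle bounding the half that
    \<open>Cbd\<close> enters, and \<open>q\<close> is the end of \<open>Cbd\<close> away from
    \<open>P\<close>. To reach \<open>q\<close>, the arc without \<open>p\<close> would have to
    cross \<open>P\<close> or \<open>Cac\<close>.\<close>
  have not_in: "False"
    if P: "arc_between P a c" "P \<inter> Cac = {a, c}" "P \<subseteq> J"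
      and Q: "arc_between Cbd p q" "Cbd \<inter> P \<subseteq> {p}" "q \<in> {b, d}" "q \<notin> P"
      and meets: "(Cbd - {p, q}) \<inter> inside (P \<union> Cac) \<noteq> {}" for P p q
  proof -
    have "q \<notin> inside (P \<union> Cac)"
      using outer Q(3) sub P cpt arc_between_compact unfolding J_def
      by (intro outer_point_notin_inside[of _ D]) auto
    moreover have "q \<in> Cbd - {p}"
      using arc_between_ends[OF Q(1)] by auto
    ultimately have "(Cbd - {p}) \<inter> frontier (inside (P \<union> Cac)) \<noteq> {}"
      using connected_Int_frontier[OF arc_between_connected_Diff[OF Q(1)], of "inside (P \<union> Cac)"] meets
      by blast
    then show False
      using Jordan_arcs(4)[OF P(1) Cac P(2)] Q(2) k3 by blast
  qed
  obtain z where z: "z \<in> Cbd" "z \<noteq> b" "z \<noteq> d"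
    using arc_between_interior_nonempty[OF Cbd] by blast
  have "z \<in> inside (L \<union> Cac) \<or> z \<in> inside (R \<union> Cac)"
    using split sub_in z k3 by blast
  moreover have "Cbd \<inter> L \<subseteq> {b}" "Cbd \<inter> R \<subseteq> {d}"
    using k2 bd LR(4) unfolding J_def by auto
  moreover have "L \<subseteq> J" "R \<subseteq> J"
    using LR(4) by auto
  ultimately show False
    using not_in[OF L LR(2) _ Cbd] not_in[OF R LR(3) _ arc_between_commute[OF Cbd]] bd z
    by blast
qed

section \<open>Paths in an outerplane drawing\<close>

abbreviation walk :: "'a set set \<Rightarrow> 'a list \<Rightarrow> bool" where
  "walk E \<equiv> successively (\<lambda>x y. {x, y} \<in> E)"

lemma walk_rev: "walk E (rev xs) = walk E xs"
  by (simp add: successively_rev insert_commute)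

lemma walk_append_shared: "walk E (xs @ x # ys) \<longleftrightarrow> walk E (xs @ [x]) \<and> walk E (x # ys)"
  by (auto simp: successively_append_iff)

fun path_edges :: "'a list \<Rightarrow> 'a set set" where
  "path_edges (x # y # zs) = insert {x, y} (path_edges (y # zs))"
| "path_edges zs = {}"

lemma path_edges_subset: "walk E xs \<Longrightarrow> path_edges xs \<subseteq> E"
  by (induction xs rule: path_edges.induct) auto

lemma Union_path_edges: "length xs \<ge> 2 \<Longrightarrow> \<Union> (path_edges xs) = set xs"
proof (induction xs rule: path_edges.induct)
  case (1 x y zs)
  then show ?case
    by (cases zs) auto
qed auto

lemma Union_path_edges_subset: "\<Union> (path_edges xs) \<subseteq> set xs"
  by (induction xs rule: path_edges.induct) auto

lemma card_path_edge: "distinct xs \<Longrightarrow> e \<in> path_edges xs \<Longrightarrow> card e = 2"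
  by (induction xs rule: path_edges.induct) auto

text \<open>The edge between the ends is the only one that two internally disjoint paths could
  share; an inner vertex rules it out.\<close>

lemma ends_notin_path_edges:
  assumes "distinct (a # P @ [b])" "P \<noteq> []"
  shows "{a, b} \<notin> path_edges (a # P @ [b])"
proof -
  obtain x Q where P: "P = x # Q"
    using assms(2) by (cases P) auto
  have "a \<notin> set (x # Q @ [b])" "b \<noteq> x"
    using assms(1) P by auto
  then have "{a, b} \<noteq> {a, x}" "{a, b} \<notin> path_edges (x # Q @ [b])"
    using Union_path_edges_subset[of "x # Q @ [b]"] by (metis doubleton_eq_iff, blast)
  then show ?thesis
    unfolding P by simp
qed

lemma disjoint_edge_sets:
  assumes "\<And>e. e \<in> F \<Longrightarrow> card e = 2" "\<Union> F \<inter> \<Union> H \<subseteq> {x}"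
  shows "F \<inter> H = {}"
proof (rule ccontr)
  assume "F \<inter> H \<noteq> {}"
  then obtain e where "e \<in> F" "e \<in> H"
    by blast
  then have "e \<subseteq> {x}"
    using assms(2) by blast
  then have "card e \<le> 1"
    using card_mono[of "{x}" e] by simp
  then show False
    using assms(1)[OF \<open>e \<in> F\<close>] by simp
qed

section \<open>From paths in the graph to arcs in the drawing\<close>

definition edges_image :: "('b \<Rightarrow> real \<Rightarrow> complex) \<Rightarrow> 'b set \<Rightarrow> complex set" where
  "edges_image g F = (\<Union>e\<in>F. path_image (g e))"

lemma edges_image_Int:
  assumes emb: "planar_embedding V E p g" and "F \<subseteq> E" "H \<subseteq> E" "F \<inter> H = {}"
  shows "edges_image g F \<inter> edges_image g H = p ` (\<Union> F \<inter> \<Union> H)"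
proof -
  have meet: "\<forall>e\<in>E. \<forall>e'\<in>E. e \<noteq> e' \<longrightarrow> path_image (g e) \<inter> path_image (g e') = p ` (e \<inter> e')"
    using emb unfolding planar_embedding_def by (elim conjE)
  have "path_image (g e) \<inter> path_image (g e') = p ` (e \<inter> e')" if "e \<in> F" "e' \<in> H" for e e'
    using meet assms(2-4) that by (metis disjoint_iff subsetD)
  then have "edges_image g F \<inter> edges_image g H = (\<Union>e\<in>F. \<Union>e'\<in>H. p ` (e \<inter> e'))"
    unfolding edges_image_def by (simp add: Int_UN_distrib2)
  also have "\<dots> = p ` (\<Union> F \<inter> \<Union> H)"
    by auto
  finally show ?thesis .
qed

lemma edges_image_subset_drawing: "F \<subseteq> E \<Longrightarrow> edges_image g F \<subseteq> drawing V E p g"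
  unfolding edges_image_def drawing_def by blast

lemma arc_between_edge:
  assumes "planar_embedding V E p g" "{a, b} \<in> E"
  shows "arc_between (path_image (g {a, b})) (p a) (p b)"
proof -
  have g: "arc (g {a, b})" "{pathstart (g {a, b}), pathfinish (g {a, b})} = {p a, p b}"
    using assms unfolding planar_embedding_def by auto
  then consider "pathstart (g {a, b}) = p a" "pathfinish (g {a, b}) = p b"
    | "pathstart (g {a, b}) = p b" "pathfinish (g {a, b}) = p a"
    by (auto simp: doubleton_eq_iff)
  then show ?thesis
  proof cases
    case 1
    then show ?thesis
      using g(1) unfolding arc_between_def by blast
  next
    case 2
    then have "arc_between (path_image (g {a, b})) (p b) (p a)"
      using g(1) unfolding arc_between_def by blast
    then show ?thesis
      by (rule arc_between_commute)
  qed
qed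

lemma arc_between_path:
  assumes emb: "planar_embedding V E p g"
  shows "distinct xs \<Longrightarrow> walk E xs \<Longrightarrow> length xs \<ge> 2 \<Longrightarrow>
    arc_between (edges_image g (path_edges xs)) (p (hd xs)) (p (last xs))"
proof (induction xs rule: path_edges.induct)
  case (1 x y zs)
  have xy: "arc_between (path_image (g {x, y})) (p x) (p y)"
    using "1.prems" by (intro arc_between_edge[OF emb]) auto
  show ?case
  proof (cases zs)
    case Nil
    then show ?thesis
      using xy by (simp add: edges_image_def)
  next
    case (Cons z ws)
    have IH: "arc_between (edges_image g (path_edges (y # zs))) (p y) (p (last (y # zs)))"
      using "1.IH" "1.prems" Cons by auto
    have "edges_image g {{x, y}} \<inter> edges_image g (path_edges (y # zs))
        = p ` (\<Union> {{x, y}} \<inter> \<Union> (path_edges (y # zs)))"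
      using "1.prems" path_edges_subset[of E "y # zs"] Union_path_edges_subset[of "y # zs"]
      by (intro edges_image_Int[OF emb]) auto
    also have "\<Union> (path_edges (y # zs)) = set (y # zs)"
      using Cons by (intro Union_path_edges) auto
    also have "p ` (\<Union> {{x, y}} \<inter> set (y # zs)) = {p y}"
      using "1.prems"(1) by auto
    finally have "path_image (g {x, y}) \<inter> edges_image g (path_edges (y # zs)) = {p y}"
      by (simp add: edges_image_def)
    from arc_between_Un[OF xy IH this] show ?thesis
      by (simp add: edges_image_def)
  qed
qed auto

locale outer_drawing =
  fixes V :: "'a set" and E p g
  assumes simple: "simple_graph V E"
    and emb: "planar_embedding V E p g"
    and outer: "\<And>v. v \<in> V \<Longrightarrow> p v \<in> frontier (outside (drawing V E p g))"
begin

lemma edge_subset: "e \<in> E \<Longrightarrow> e \<subseteq> V"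
  using simple unfolding simple_graph_def by blast

lemma p_eq_iff: "x \<in> V \<Longrightarrow> y \<in> V \<Longrightarrow> p x = p y \<longleftrightarrow> x = y"
  using emb unfolding planar_embedding_def by (meson inj_on_eq_iff)

lemma walk_subset: "walk E xs \<Longrightarrow> length xs \<ge> 2 \<Longrightarrow> set xs \<subseteq> V"
  using Union_path_edges[of xs] path_edges_subset[of E xs] edge_subset by blast

lemma point_in_edge_image:
  assumes "e \<in> E" "x \<in> e"
  shows "p x \<in> path_image (g e)"
proof -
  have "path_image (g e) \<inter> p ` V = p ` e"
    using emb assms(1) unfolding planar_embedding_def by simp
  then show ?thesis
    using assms(2) by blast
qed

lemma vertex_in_edges_image: "F \<subseteq> E \<Longrightarrow> x \<in> \<Union> F \<Longrightarrow> p x \<in> edges_image g F"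
  using point_in_edge_image unfolding edges_image_def by blast

lemma no_theta:
  assumes P: "distinct (a # P @ [b])" "walk E (a # P @ [b])" "P \<noteq> []"
    and Q: "distinct (a # Q @ [b])" "walk E (a # Q @ [b])" "Q \<noteq> []"
    and R: "distinct (a # R @ [b])" "walk E (a # R @ [b])" "R \<noteq> []"
    and disj: "set P \<inter> set Q = {}" "set P \<inter> set R = {}" "set Q \<inter> set R = {}"
  shows False
proof -
  let ?I = "\<lambda>X. edges_image g (path_edges (a # X @ [b]))"
  have arcs: "arc_between (?I X) (p a) (p b)"
    if "distinct (a # X @ [b])" "walk E (a # X @ [b])" for X
    using arc_between_path[OF emb that] by simp
  have Un: "\<Union> (path_edges (a # X @ [b])) = insert a (insert b (set X))" for X
    by (subst Union_path_edges) auto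
  have int: "?I X \<inter> ?I Y = {p a, p b}"
    if X: "distinct (a # X @ [b])" "walk E (a # X @ [b])" "X \<noteq> []"
      and Y: "distinct (a # Y @ [b])" "walk E (a # Y @ [b])" and XY: "set X \<inter> set Y = {}" for X Y
  proof -
    have "path_edges (a # X @ [b]) \<inter> path_edges (a # Y @ [b]) = {}"
    proof (rule ccontr)
      assume "path_edges (a # X @ [b]) \<inter> path_edges (a # Y @ [b]) \<noteq> {}"
      then obtain e where e: "e \<in> path_edges (a # X @ [b])" "e \<in> path_edges (a # Y @ [b])"
        by blast
      then have "e \<subseteq> {a, b}"
        using Un[of X] Un[of Y] XY by blast
      moreover have "card e = 2"
        using card_path_edge[OF X(1) e(1)] .
      moreover have "card {a, b} = 2"
        using X(1) by auto
      ultimately have "e = {a, b}"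
        by (metis card_subset_eq finite.emptyI finite.insertI)
      then show False
        using e(1) ends_notin_path_edges X by metis
    qed
    then have "?I X \<inter> ?I Y = p ` (\<Union> (path_edges (a # X @ [b])) \<inter> \<Union> (path_edges (a # Y @ [b])))"
      using X(2) Y(2) by (intro edges_image_Int[OF emb] path_edges_subset)
    also have "\<dots> = p ` {a, b}"
      unfolding Un using X(1) Y(1) XY by (intro arg_cong[of _ _ "image p"]) auto
    finally show ?thesis
      by simp
  qed
  \<comment> \<open>The first inner vertex of each path serves as the marked outer point of its
    arc.\<close>
  have pt: "p (hd X) \<in> ?I X - {p a, p b} \<and> p (hd X) \<in> frontier (outside (drawing V E p g))"
    if X: "distinct (a # X @ [b])" "walk E (a # X @ [b])" "X \<noteq> []" for X
  proof -
    have "hd X \<in> set X" and sub: "set (a # X @ [b]) \<subseteq> V"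
      using X walk_subset[OF X(2)] by auto
    then have "hd X \<in> V" "hd X \<noteq> a" "hd X \<noteq> b" "a \<in> V" "b \<in> V"
      using X(1) by auto
    moreover have "p (hd X) \<in> ?I X"
      using \<open>hd X \<in> set X\<close> Un[of X] path_edges_subset[OF X(2)]
      by (intro vertex_in_edges_image) auto
    ultimately show ?thesis
      using outer p_eq_iff by auto
  qed
  have sub: "?I X \<subseteq> drawing V E p g" if "walk E (a # X @ [b])" for X
    using path_edges_subset[OF that] by (rule edges_image_subset_drawing)
  show False
    by (rule no_outer_theta[OF arcs[OF P(1,2)] arcs[OF Q(1,2)] arcs[OF R(1,2)]
          int[OF P Q(1,2) disj(1)] int[OF P R(1,2) disj(2)] int[OF Q R(1,2) disj(3)],
          of "drawing V E p g" "p (hd P)" "p (hd Q)" "p (hd R)"])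
      (use sub[OF P(2)] sub[OF Q(2)] sub[OF R(2)] pt[OF P] pt[OF Q] pt[OF R] in auto)
qed

lemma no_crossing_chords:
  assumes dist: "distinct (a # P @ b # Q @ c # R @ d # S)"
    and w: "walk E (a # P @ b # Q @ c # R @ d # S @ [a])"
    and chords: "{a, c} \<in> E" "{b, d} \<in> E"
  shows False
proof -
  define FP where "FP = path_edges (a # P @ [b])"
  define FQ where "FQ = path_edges (b # Q @ [c])"
  define FR where "FR = path_edges (c # R @ [d])"
  define FS where "FS = path_edges (d # S @ [a])"
  note F_defs = FP_def FQ_def FR_def FS_def
  have ws: "walk E (a # P @ [b])" "walk E (b # Q @ [c])" "walk E (c # R @ [d])" "walk E (d # S @ [a])"
    using w walk_append_shared[of E "a # P" b "Q @ c # R @ d # S @ [a]"]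
      walk_append_shared[of E "b # Q" c "R @ d # S @ [a]"] walk_append_shared[of E "c # R" d "S @ [a]"]
    by auto
  have Un: "\<Union> FP = insert a (insert b (set P))" "\<Union> FQ = insert b (insert c (set Q))"
    "\<Union> FR = insert c (insert d (set R))" "\<Union> FS = insert d (insert a (set S))"
    unfolding F_defs by (subst Union_path_edges; auto)+
  have sub: "FP \<subseteq> E" "FQ \<subseteq> E" "FR \<subseteq> E" "FS \<subseteq> E"
    unfolding F_defs using ws path_edges_subset by blast+
  have arcs: "arc_between (edges_image g FP) (p a) (p b)" "arc_between (edges_image g FQ) (p b) (p c)"
    "arc_between (edges_image g FR) (p c) (p d)" "arc_between (edges_image g FS) (p d) (p a)"
    unfolding F_defs using dist
      arc_between_path[OF emb, of "a # P @ [b]"] arc_between_path[OF emb, of "b # Q @ [c]"]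
      arc_between_path[OF emb, of "c # R @ [d]"] arc_between_path[OF emb, of "d # S @ [a]"] ws
    by auto
  have ac: "arc_between (edges_image g {{a, c}}) (p a) (p c)"
    and bd: "arc_between (edges_image g {{b, d}}) (p b) (p d)"
    using arc_between_edge[OF emb] chords by (auto simp: edges_image_def)
  have card2: "card e = 2" if "e \<in> E" for e
    using simple that unfolding simple_graph_def by blast
  have int: "edges_image g F \<inter> edges_image g H = p ` (\<Union> F \<inter> \<Union> H)"
    if "F \<subseteq> E" "H \<subseteq> E" "\<Union> F \<inter> \<Union> H \<subseteq> {x}" for F H x
    using that card2 by (intro edges_image_Int[OF emb] disjoint_edge_sets[of F H x]) auto
  have rim: "edges_image g (FP \<union> FQ \<union> FR \<union> FS)
      = edges_image g FP \<union> edges_image g FQ \<union> edges_image g FR \<union> edges_image g FS"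
    by (auto simp: edges_image_def)
  have chord: "edges_image g {e} \<inter> edges_image g (FP \<union> FQ \<union> FR \<union> FS) = p ` e"
    if "e \<in> E" "e \<notin> FP \<union> FQ \<union> FR \<union> FS" "e \<subseteq> {a, b, c, d}" for e
  proof -
    have "edges_image g {e} \<inter> edges_image g (FP \<union> FQ \<union> FR \<union> FS)
        = p ` (\<Union> {e} \<inter> \<Union> (FP \<union> FQ \<union> FR \<union> FS))"
      using that sub by (intro edges_image_Int[OF emb]) auto
    also have "\<Union> {e} \<inter> \<Union> (FP \<union> FQ \<union> FR \<union> FS) = e"
      using that(3) Un by auto
    finally show ?thesis .
  qed
  \<comment> \<open>No rim segment contains both ends of the chord, so the chord is not a rim edge
    and meets the rim only in its ends.\<close>
  have ac_notin: "{a, c} \<notin> FP \<union> FQ \<union> FR \<union> FS"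
  proof -
    have "\<not> {a, c} \<subseteq> \<Union> FP" "\<not> {a, c} \<subseteq> \<Union> FQ" "\<not> {a, c} \<subseteq> \<Union> FR" "\<not> {a, c} \<subseteq> \<Union> FS"
      unfolding Un using dist by auto
    then show ?thesis
      by (metis UnE Union_upper)
  qed
  have bd_notin: "{b, d} \<notin> FP \<union> FQ \<union> FR \<union> FS"
  proof -
    have "\<not> {b, d} \<subseteq> \<Union> FP" "\<not> {b, d} \<subseteq> \<Union> FQ" "\<not> {b, d} \<subseteq> \<Union> FR" "\<not> {b, d} \<subseteq> \<Union> FS"
      unfolding Un using dist by auto
    then show ?thesis
      by (metis UnE Union_upper)
  qed
  have V: "{a, b, c, d} \<subseteq> V"
    using chords edge_subset by blast
  show False
  proof (rule no_outer_crossing_chords[OF arcs ac bd])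
    have i: "\<Union> FP \<inter> \<Union> FQ = {b}" "\<Union> FQ \<inter> \<Union> FR = {c}" "\<Union> FR \<inter> \<Union> FS = {d}" "\<Union> FS \<inter> \<Union> FP = {a}"
      "\<Union> FP \<inter> \<Union> FR = {}" "\<Union> FQ \<inter> \<Union> FS = {}"
      unfolding Un using dist by auto
    show "edges_image g FP \<inter> edges_image g FQ = {p b}" "edges_image g FQ \<inter> edges_image g FR = {p c}"
      "edges_image g FR \<inter> edges_image g FS = {p d}" "edges_image g FS \<inter> edges_image g FP = {p a}"
      "edges_image g FP \<inter> edges_image g FR = {}" "edges_image g FQ \<inter> edges_image g FS = {}"
      using int[OF sub(1) sub(2)] int[OF sub(2) sub(3)] int[OF sub(3) sub(4)] int[OF sub(4) sub(1)]
        int[OF sub(1) sub(3)] int[OF sub(2) sub(4)] unfolding i by auto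
    show "edges_image g {{a, c}} \<inter> (edges_image g FP \<union> edges_image g FQ \<union> edges_image g FR \<union> edges_image g FS)
      = {p a, p c}"
      using chord[OF chords(1) ac_notin] unfolding rim by auto
    show "edges_image g {{b, d}} \<inter> (edges_image g FP \<union> edges_image g FQ \<union> edges_image g FR \<union> edges_image g FS)
      = {p b, p d}"
      using chord[OF chords(2) bd_notin] unfolding rim by auto
    have "{a, c} \<inter> {b, d} = {}"
      using dist by auto
    then show "edges_image g {{a, c}} \<inter> edges_image g {{b, d}} = {}"
      using int[of "{{a, c}}" "{{b, d}}"] chords by auto
    show "edges_image g FP \<union> edges_image g FQ \<union> edges_image g FR \<union> edges_image g FS
        \<union> edges_image g {{a, c}} \<union> edges_image g {{b, d}} \<subseteq> drawing V E p g"
      using sub chords by (simp add: edges_image_subset_drawing)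
    show "{p a, p b, p c, p d} \<subseteq> frontier (outside (drawing V E p g))"
      using V outer by auto
  qed
qed

end

section \<open>Vertex orders without crossing edges\<close>

text \<open>This property and \<open>chords_noncrossing\<close> are all that is kept of the drawing;
  from here on the argument is combinatorial. The lists hold the inner vertices of paths, and one
  \<open>distinct\<close> expresses every disjointness condition at once.\<close>

definition theta_free :: "'a set set \<Rightarrow> bool" where
  "theta_free E \<longleftrightarrow> (\<forall>a b P Q R. distinct (a # b # P @ Q @ R) \<and> P \<noteq> [] \<and> Q \<noteq> [] \<and> R \<noteq> [] \<longrightarrow>
     \<not> (walk E (a # P @ [b]) \<and> walk E (a # Q @ [b]) \<and> walk E (a # R @ [b])))"

definition chords_noncrossing :: "'a set set \<Rightarrow> bool" where
  "chords_noncrossing E \<longleftrightarrow> (\<forall>a b c d P Q R S. distinct (a # P @ b # Q @ c # R @ d # S) \<and>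
     walk E (a # P @ b # Q @ c # R @ d # S @ [a]) \<longrightarrow> \<not> ({a, c} \<in> E \<and> {b, d} \<in> E))"

lemma chords_noncrossingD:
  assumes "chords_noncrossing E" "distinct (a # P @ b # Q @ c # R @ d # S)"
    and "walk E (a # P @ b # Q @ c # R @ d # S @ [a])"
  shows "\<not> ({a, c} \<in> E \<and> {b, d} \<in> E)"
  using assms unfolding chords_noncrossing_def by blast

section \<open>One-page orders: rotation and gluing\<close>

text \<open>A one-page book embedding with spine order \<open>f\<close>. Only edges between vertices
  of \<open>V\<close> are constrained, so \<open>E\<close> can stay fixed while the vertex set is
  cut into parts.\<close>

definition one_page :: "'a set \<Rightarrow> 'a set set \<Rightarrow> ('a \<Rightarrow> nat) \<Rightarrow> bool" where
  "one_page V E f \<longleftrightarrow> inj_on f V \<and>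
     (\<forall>a\<in>V. \<forall>b\<in>V. \<forall>c\<in>V. \<forall>d\<in>V. f a < f b \<and> f b < f c \<and> f c < f d \<longrightarrow>
        \<not> ({a, c} \<in> E \<and> {b, d} \<in> E))"

lemma one_pageD:
  assumes "one_page V E f" "f a < f b" "f b < f c" "f c < f d" "{a, c} \<in> E" "{b, d} \<in> E"
    and "a \<in> V" "b \<in> V" "c \<in> V" "d \<in> V"
  shows False
  using assms unfolding one_page_def by blast

text \<open>Bending the line into a circle turns the half circles into chords, and whether chords
  cross depends only on the cyclic order of their ends.\<close>

lemma one_page_rotate:
  assumes f: "one_page V E f" and "finite V" "v \<in> V"
  obtains h where "one_page V E h" "h v = 0"
proof -
  define M where "M = Suc (Max (f ` V))"
  have less: "f x < M" if "x \<in> V" for x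
    using that assms(2) unfolding M_def by (simp add: le_imp_less_Suc)
  \<comment> \<open>Values below \<open>f v\<close> are moved up by \<open>M\<close>, past all
    others; then everything is lowered by \<open>f v\<close>.\<close>
  define h where "h x = (if f v \<le> f x then f x - f v else f x + M - f v)" for x
  have inj: "x = y" if "h x = h y" "x \<in> V" "y \<in> V" for x y
  proof -
    have "f x = f y"
      using that(1) less[OF that(2)] less[OF that(3)] less[OF assms(3)]
      unfolding h_def by (auto split: if_splits)
    then show ?thesis
      using f that unfolding one_page_def by (meson inj_on_eq_iff)
  qed
  have cross: False
    if V: "a \<in> V" "b \<in> V" "c \<in> V" "d \<in> V" and lt: "h a < h b" "h b < h c" "h c < h d"
      and e: "{a, c} \<in> E" "{b, d} \<in> E" for a b c d
  proof -
    have e': "{c, a} \<in> E" "{d, b} \<in> E"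
      using e by (simp_all add: insert_commute)
    have lt_iff: "h x < h y \<longleftrightarrow> (if f v \<le> f x then f x < f y \<or> f y < f v else f x < f y \<and> f y < f v)"
      if "x \<in> V" "y \<in> V" for x y
      using less[OF that(1)] less[OF that(2)] less[OF assms(3)] unfolding h_def by auto
    \<comment> \<open>A chain for \<open>h\<close> is one of the four cyclic rotations of a chain
      for \<open>f\<close>.\<close>
    have "f a < f b \<and> f b < f c \<and> f c < f d \<or> f d < f a \<and> f a < f b \<and> f b < f c
        \<or> f c < f d \<and> f d < f a \<and> f a < f b \<or> f b < f c \<and> f c < f d \<and> f d < f a"
      using lt unfolding lt_iff[OF V(1,2)] lt_iff[OF V(2,3)] lt_iff[OF V(3,4)]
      by (auto split: if_splits)
    then show False
      using one_pageD[OF f, of a b c d] one_pageD[OF f, of d a b c] one_pageD[OF f, of c d a b]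
        one_pageD[OF f, of b c d a] V e e' by blast
  qed
  have "one_page V E h"
    unfolding one_page_def inj_on_def using inj cross by blast
  moreover have "h v = 0"
    by (simp add: h_def)
  ultimately show ?thesis
    by (rule that)
qed

text \<open>The order of the second part, rotated so that it starts with the common vertex, is inserted
  into the order of the first part right behind that vertex.\<close>

lemma one_page_glue:
  assumes A: "one_page A E fA" and B: "one_page B E fB"
    and fin: "finite B" and v: "A \<inter> B = {v}"
    and edges: "\<And>x y. {x, y} \<in> E \<Longrightarrow> x \<in> A \<union> B \<Longrightarrow> y \<in> A \<union> B \<Longrightarrow> {x, y} \<subseteq> A \<or> {x, y} \<subseteq> B"
  shows "\<exists>f. one_page (A \<union> B) E f"
proof -
  obtain h where h: "one_page B E h" "h v = 0"
    using one_page_rotate[OF B fin, of v] v by blast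
  define M where "M = Suc (Max (h ` B))"
  have less: "h x < M" if "x \<in> B" for x
    using that fin unfolding M_def by (simp add: le_imp_less_Suc)
  then have "M > 0"
    using v by fastforce
  \<comment> \<open>Scaling by \<open>M\<close> reserves a block of \<open>M\<close> places for each
    vertex of \<open>A\<close>. Since \<open>h < M\<close> on \<open>B\<close>, all of
    \<open>B\<close> fits into the block of \<open>v\<close>, and \<open>h v = 0\<close> makes both
    descriptions agree at \<open>v\<close>.\<close>
  define f where "f x = (if x \<in> A then fA x * M else fA v * M + h x)" for x
  have fA: "f x = fA x * M" if "x \<in> A" for x
    using that by (simp add: f_def)
  have fB: "f x = fA v * M + h x" if "x \<in> B" for x
    using that v h(2) by (cases "x = v") (auto simp: f_def)
  have block: "fA x = fA v \<and> h y = 0" if "x \<in> A" "y \<in> B" "f x = f y" for x y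
  proof -
    have "fA x * M = fA v * M + h y"
      using that fA fB by auto
    then have "fA x * M div M = (fA v * M + h y) div M" "fA x * M mod M = (fA v * M + h y) mod M"
      by simp_all
    then show ?thesis
      using less[OF that(2)] \<open>M > 0\<close> by simp
  qed
  have inside: False if "x \<in> A" "y \<in> B" "z \<in> B" "f y < f x" "f x < f z" for x y z
  proof -
    have "fA v * M < fA x * M" "fA x * M < fA v * M + M"
      using that(4,5) fA[OF that(1)] fB[OF that(2)] fB[OF that(3)] less[OF that(3)] by linarith+
    then have "\<not> fA x \<le> fA v" "\<not> Suc (fA v) \<le> fA x"
      using mult_le_mono1[of "fA x" "fA v" M] mult_le_mono1[of "Suc (fA v)" "fA x" M] by auto
    then show False
      by simp
  qed
  have injA: "inj_on fA A" and injB: "inj_on h B"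
    using A h(1) unfolding one_page_def by auto
  have vAB: "v \<in> A" "v \<in> B"
    using v by auto
  have mixed: "x = y" if "x \<in> A" "y \<in> B" "f x = f y" for x y
    using block[OF that] vAB that h(2) injA injB by (metis inj_on_eq_iff)
  have inj: "x = y" if xy: "x \<in> A \<union> B" "y \<in> A \<union> B" "f x = f y" for x y
  proof -
    consider "x \<in> A" "y \<in> A" | "x \<in> B" "y \<in> B" | "x \<in> A" "y \<in> B" | "y \<in> A" "x \<in> B"
      using xy by blast
    then show ?thesis
    proof cases
      case 1
      then show ?thesis
        using xy(3) fA injA \<open>M > 0\<close> by (auto dest: inj_onD)
    next
      case 2
      then show ?thesis
        using xy(3) fB injB by (auto dest: inj_onD)
    qed (use mixed xy(3) in metis)+
  qed
  have cross: False
    if V: "a \<in> A \<union> B" "b \<in> A \<union> B" "c \<in> A \<union> B" "d \<in> A \<union> B"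
      and lt: "f a < f b" "f b < f c" "f c < f d" and e: "{a, c} \<in> E" "{b, d} \<in> E" for a b c d
  proof -
    \<comment> \<open>A crossing between an edge of \<open>A\<close> and an edge of \<open>B\<close>
      would put a vertex of \<open>A\<close> strictly between two vertices of \<open>B\<close>,
      which \<open>inside\<close> forbids.\<close>
    consider "{a, b, c, d} \<subseteq> A" | "{a, b, c, d} \<subseteq> B" | "{a, c} \<subseteq> A" "{b, d} \<subseteq> B" | "{a, c} \<subseteq> B" "{b, d} \<subseteq> A"
      using edges[OF e(1) V(1,3)] edges[OF e(2) V(2,4)] by blast
    then show False
    proof cases
      case 1
      then show False
        using lt e fA by (intro one_pageD[OF A, of a b c d]) auto
    next
      case 2
      then show False
        using lt e fB by (intro one_pageD[OF h(1), of a b c d]) auto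
    next
      case 3
      then show False
        using inside[of c b d] lt by auto
    next
      case 4
      then show False
        using inside[of b a c] lt by auto
    qed
  qed
  show ?thesis
    unfolding one_page_def inj_on_def using inj cross by blast
qed

section \<open>Hamiltonian cycles in graphs without cut vertices\<close>

text \<open>The ends of paths from \<open>x\<close> that avoid \<open>D\<close> form a proper subset
  of \<open>W\<close>, so some edge leaves it. Its far end must lie in \<open>D\<close>, for
  otherwise the path could be extended.\<close>

lemma path_to_set:
  assumes conn: "\<And>X. X \<subseteq> W \<Longrightarrow> X \<noteq> {} \<Longrightarrow> X \<noteq> W \<Longrightarrow> \<exists>x\<in>X. \<exists>y\<in>W - X. {x, y} \<in> E"
    and x: "x \<in> W - D" and D: "D \<subseteq> W" "D \<noteq> {}"
  obtains P d where "distinct P" "walk E (P @ [d])" "P \<noteq> []" "hd P = x" "set P \<subseteq> W - D" "d \<in> D"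
proof -
  define path where "path P \<longleftrightarrow> distinct P \<and> walk E P \<and> P \<noteq> [] \<and> hd P = x \<and> set P \<subseteq> W - D" for P
  define X where "X = last ` Collect path"
  have "path [x]"
    using x by (simp add: path_def)
  then have "last [x] \<in> X"
    unfolding X_def by blast
  then have "X \<noteq> {}"
    by blast
  moreover have X: "X \<subseteq> W - D"
    unfolding X_def path_def using last_in_set by fastforce
  moreover have "X \<noteq> W"
    using X D by blast
  ultimately obtain y z where yz: "y \<in> X" "z \<in> W - X" "{y, z} \<in> E"
    using conn[of X] by blast
  obtain P where P: "path P" "last P = y"
    using yz(1) unfolding X_def by blast
  have w: "walk E (P @ [z])"
    using P yz(3) unfolding path_def by (auto simp: successively_append_iff)
  have "z \<in> D"
  proof (rule ccontr)
    assume "z \<notin> D"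
    have "path (P @ [z])" if "z \<notin> set P"
      using that P w yz(2) \<open>z \<notin> D\<close> unfolding path_def by auto
    moreover have "z \<in> X" if "path (P @ [z])"
      using that unfolding X_def by force
    \<comment> \<open>If the new vertex is already on the path, the path is cut off there.\<close>
    moreover have "z \<in> X" if zP: "z \<in> set P"
    proof -
      obtain P1 P2 where P12: "P = P1 @ z # P2"
        using zP by (meson split_list)
      then have "path (P1 @ [z])"
        using P walk_append_shared[of E P1 z P2] unfolding path_def by (auto simp: hd_append)
      then show ?thesis
        unfolding X_def by force
    qed
    ultimately show False
      using yz(2) by blast
  qed
  then show ?thesis
    using P w that[of P z] unfolding path_def by blast
qed

text \<open>Connectedness of every \<open>V - {v}\<close>, in the cut form that
  \<open>path_to_set\<close> takes. A disconnected graph with at least three vertices also violates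
  it.\<close>

definition nonseparable :: "'a set \<Rightarrow> 'a set set \<Rightarrow> bool" where
  "nonseparable V E \<longleftrightarrow> (\<forall>v\<in>V. \<forall>X. X \<subseteq> V - {v} \<longrightarrow> X \<noteq> {} \<longrightarrow> X \<noteq> V - {v} \<longrightarrow>
     (\<exists>x\<in>X. \<exists>y\<in>V - {v} - X. {x, y} \<in> E))"

definition cycle_in :: "'a set \<Rightarrow> 'a set set \<Rightarrow> 'a list \<Rightarrow> bool" where
  "cycle_in V E C \<longleftrightarrow> distinct C \<and> length C \<ge> 3 \<and> set C \<subseteq> V \<and> walk E (C @ [hd C])"

lemma cycle_in_rotate:
  assumes "cycle_in V E (xs @ ys)"
  shows "cycle_in V E (ys @ xs)"
proof (cases "xs = [] \<or> ys = []")
  case False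
  then obtain x xs' y ys' where "xs = x # xs'" "ys = y # ys'"
    by (metis neq_Nil_conv)
  then show ?thesis
    using assms walk_append_shared[of E "x # xs'" y "ys' @ [x]"] walk_append_shared[of E "y # ys'" x "xs' @ [y]"]
    unfolding cycle_in_def by auto
qed (use assms in auto)

text \<open>A vertex \<open>x\<close> has two neighbours \<open>y\<close> and \<open>z\<close>; a
  path from \<open>z\<close> to \<open>y\<close> avoiding \<open>x\<close> closes up to a cycle
  through \<open>x\<close>.\<close>

lemma nonseparable_cycle:
  assumes ns: "nonseparable V E" and "finite V" "card V \<ge> 4"
  shows "\<exists>C. cycle_in V E C"
proof -
  \<comment> \<open>Nonseparability at \<open>y\<close> is applied to the singleton
    \<open>{x}\<close>, which is not all of \<open>V - {y}\<close>.\<close>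
  have nbr: "\<exists>z\<in>V - {y} - {x}. {x, z} \<in> E" if "x \<in> V" "y \<in> V" "x \<noteq> y" for x y
  proof -
    have "card {x} \<noteq> card (V - {y})"
      using assms(2,3) that by simp
    then have "{x} \<noteq> V - {y}"
      by (rule contrapos_nn) (simp only:)
    moreover have "{x} \<subseteq> V - {y}"
      using that by blast
    ultimately show ?thesis
      using ns that(2) unfolding nonseparable_def by blast
  qed
  have "\<not> card V \<le> Suc 0"
    using assms(3) by simp
  then obtain x w where xw: "x \<in> V" "w \<in> V" "x \<noteq> w"
    using card_le_Suc0_iff_eq[OF assms(2)] by blast
  obtain y where y: "y \<in> V" "y \<noteq> x" "{x, y} \<in> E"
    using nbr[OF xw] by blast
  obtain z where z: "z \<in> V" "z \<noteq> x" "z \<noteq> y" "{x, z} \<in> E"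
    using nbr[OF xw(1) y(1)] y(2) by blast
  obtain P d where P: "distinct P" "walk E (P @ [d])" "P \<noteq> []" "hd P = z"
    "set P \<subseteq> (V - {x}) - {y}" "d \<in> {y}"
    using ns xw(1) y z unfolding nonseparable_def
    by (elim path_to_set[where W = "V - {x}" and E = E and x = z and D = "{y}", rotated -1]) auto
  have "walk E (x # P @ [y] @ [x])"
    using P y z by (auto simp: successively_Cons successively_append_iff insert_commute)
  then have "cycle_in V E (x # P @ [y])"
    using P xw y unfolding cycle_in_def by (cases P) auto
  then show ?thesis
    by blast
qed

text \<open>A longest cycle is Hamiltonian: otherwise it has an ear, whose ends are adjacent on the
  cycle (then the cycle can be extended) or span a theta graph.\<close>

lemma Hamiltonian_cycle:
  assumes theta: "theta_free E" and ns: "nonseparable V E" and "finite V" "card V \<ge> 4"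
  shows "\<exists>C. cycle_in V E C \<and> set C = V"
proof -
  have bound: "length C \<le> card V" if "cycle_in V E C" for C
    using that assms(3) unfolding cycle_in_def by (metis card_mono distinct_card)
  obtain C0 where "cycle_in V E C0"
    using nonseparable_cycle[OF ns assms(3,4)] by blast
  then have "\<exists>C. cycle_in V E C \<and> (\<forall>C'. cycle_in V E C' \<longrightarrow> length C' \<le> length C)"
    by (rule ex_has_greatest_nat[where f = length and b = "Suc (card V)"]) (simp add: bound le_imp_less_Suc)
  then obtain C where C: "cycle_in V E C" and max: "\<And>C'. cycle_in V E C' \<Longrightarrow> length C' \<le> length C"
    by blast
  have "set C = V"
  proof (rule ccontr)
    assume neq: "set C \<noteq> V"
    have C0: "hd C \<in> set C" "set C \<subseteq> V" "distinct C" "length C \<ge> 3"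
      using C unfolding cycle_in_def by (auto intro!: hd_in_set)
    have "set C - {hd C} \<noteq> {}"
    proof
      assume "set C - {hd C} = {}"
      then have "card (set C) \<le> card {hd C}"
        by (intro card_mono) auto
      then show False
        using C0 by (simp add: distinct_card)
    qed
    moreover have "set C - {hd C} \<subseteq> V - {hd C}" "set C - {hd C} \<noteq> V - {hd C}" "hd C \<in> V"
      using C0 neq by auto
    \<comment> \<open>Nonseparability at \<open>hd C\<close>, applied to the rest of the cycle,
      yields an edge leaving the cycle.\<close>
    ultimately obtain c x where cx: "c \<in> set C" "x \<in> V" "x \<notin> set C" "{c, x} \<in> E"
      using ns C0(1) unfolding nonseparable_def by (metis Diff_iff singletonD)
    obtain l r where lr: "C = l @ c # r"
      using cx(1) by (meson split_list)
    define T where "T = r @ l"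
    have T: "cycle_in V E (c # T)" "length (c # T) = length C" "set (c # T) = set C"
      using cycle_in_rotate[of V E l "c # r"] C unfolding lr T_def by auto
    have cT: "c \<notin> set T" "distinct T" "set T \<subseteq> V - {c}" "length T \<ge> 2" "c \<in> V" "set T \<noteq> {}"
      using T(1) unfolding cycle_in_def by auto
    have conn: "\<And>X. X \<subseteq> V - {c} \<Longrightarrow> X \<noteq> {} \<Longrightarrow> X \<noteq> V - {c} \<Longrightarrow> \<exists>x\<in>X. \<exists>y\<in>V - {c} - X. {x, y} \<in> E"
      using ns cT(5) unfolding nonseparable_def by blast
    have "x \<in> V - {c} - set T"
      using cx T(3) by auto
    \<comment> \<open>Even without \<open>c\<close> the vertex \<open>x\<close> is linked to the
      rest \<open>T\<close> of the cycle; with the edge from \<open>c\<close> to \<open>x\<close>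
      this is an ear from \<open>c\<close> to \<open>d\<close> with inner vertices
      \<open>P\<close>.\<close>
    then obtain P d where P: "distinct P" "walk E (P @ [d])" "P \<noteq> []" "hd P = x"
      "set P \<subseteq> V - {c} - set T" "d \<in> set T"
      using path_to_set[OF conn _ cT(3,6)] by blast
    obtain T1 T2 where T12: "T = T1 @ d # T2"
      using P(6) by (meson split_list)
    have w: "walk E (c # T1 @ [d])" "walk E (d # T2 @ [c])"
      using T(1) walk_append_shared[of E "c # T1" d "T2 @ [c]"] unfolding cycle_in_def T12 by auto
    have wP: "walk E (c # P @ [d])"
      using P(2-4) cx(4) by (cases P) auto
    have wP': "walk E (d # rev P @ [c])"
      using wP walk_rev[of E "c # P @ [d]"] by simp
    have w2': "walk E (c # rev T2 @ [d])"
      using w(2) walk_rev[of E "d # T2 @ [c]"] by simp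
    consider "T1 = []" | "T2 = []" | "T1 \<noteq> []" "T2 \<noteq> []"
      by blast
    then show False
    proof cases
      \<comment> \<open>Here \<open>d\<close> follows \<open>c\<close> directly, and replacing that
        edge by the ear lengthens the cycle.\<close>
      case 1
      have "cycle_in V E (c # P @ d # T2)"
        using cT P w(2) wP walk_append_shared[of E "c # P" d "T2 @ [c]"] 1
        unfolding cycle_in_def T12 by auto
      from max[OF this] show False
        using T(2) 1 P(3) unfolding T12 by (cases P) auto
    next
      case 2
      have "cycle_in V E (c # T1 @ d # rev P)"
        using cT P w(1) wP' walk_append_shared[of E "c # T1" d "rev P @ [c]"] 2
        unfolding cycle_in_def T12 by auto
      from max[OF this] show False
        using T(2) 2 P(3) unfolding T12 by (cases P) auto
    next
      \<comment> \<open>The ear and the two sides of the cycle are three paths from \<open>c\<close>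
        to \<open>d\<close>, each with an inner vertex.\<close>
      case 3
      have "distinct (c # d # P @ T1 @ rev T2)"
        using cT P unfolding T12 by auto
      then show False
        using theta 3 P(3) w(1) w2' wP unfolding theta_free_def by (metis rev_is_Nil_conv)
    qed
  qed
  then show ?thesis
    using C by blast
qed

lemma drop_split:
  assumes "i < j" "j < length xs"
  shows "drop i xs = xs ! i # take (j - Suc i) (drop (Suc i) xs) @ drop j xs"
proof -
  have "drop j xs = drop (j - Suc i) (drop (Suc i) xs)"
    using assms(1) by simp
  then show ?thesis
    using assms by (metis Cons_nth_drop_Suc append_take_drop_id less_trans)
qed

text \<open>The order is the position on the cycle: crossing edges would be crossing chords of the
  cycle, once it is rotated to start at \<open>a\<close>.\<close>

lemma Hamiltonian_one_page:
  assumes nc: "chords_noncrossing E" and C: "cycle_in V E C"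
  shows "\<exists>f. one_page (set C) E f"
proof -
  have "\<forall>x\<in>set C. \<exists>i. i < length C \<and> C ! i = x"
    by (simp add: in_set_conv_nth)
  then obtain f where f: "\<And>x. x \<in> set C \<Longrightarrow> f x < length C \<and> C ! f x = x"
    by metis
  have "inj_on f (set C)"
    by (rule inj_on_inverseI[of _ "(!) C"]) (use f in blast)
  moreover have False
    if V: "a \<in> set C" "b \<in> set C" "c \<in> set C" "d \<in> set C" and lt: "f a < f b" "f b < f c" "f c < f d"
      and e: "{a, c} \<in> E" "{b, d} \<in> E" for a b c d
  proof -
    obtain P where P: "drop (f a) C = a # P @ drop (f b) C"
      using drop_split[of "f a" "f b" C] lt f V by metis
    obtain Q where Q: "drop (f b) C = b # Q @ drop (f c) C"
      using drop_split[of "f b" "f c" C] lt f V by metis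
    obtain R where R: "drop (f c) C = c # R @ drop (f d) C"
      using drop_split[of "f c" "f d" C] lt f V by metis
    obtain S where S: "drop (f d) C = d # S"
      using f[OF V(4)] by (metis Cons_nth_drop_Suc)
    have "C = take (f a) C @ a # P @ b # Q @ c # R @ d # S"
      using P Q R S by (metis append_take_drop_id)
    then have "cycle_in V E ((a # P @ b # Q @ c # R @ d # S) @ take (f a) C)"
      using C cycle_in_rotate by metis
    then have "distinct (a # P @ b # Q @ c # R @ d # (S @ take (f a) C))"
      "walk E (a # P @ b # Q @ c # R @ d # (S @ take (f a) C) @ [a])"
      unfolding cycle_in_def by simp_all
    then show False
      using chords_noncrossingD[OF nc] e by blast
  qed
  ultimately show ?thesis
    unfolding one_page_def by blast
qed

lemma one_page_le_3:
  assumes "finite V" "card V \<le> 3"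
  shows "\<exists>f. one_page V E f"
proof -
  obtain f :: "'a \<Rightarrow> nat" where f: "inj_on f V"
    using finite_imp_inj_to_nat_seg[OF assms(1)] by blast
  have False if "a \<in> V" "b \<in> V" "c \<in> V" "d \<in> V" "f a < f b" "f b < f c" "f c < f d" for a b c d
  proof -
    have "a \<noteq> b" "a \<noteq> c" "a \<noteq> d" "b \<noteq> c" "b \<noteq> d" "c \<noteq> d"
      using that(5-7) by auto
    then have "card {a, b, c, d} = 4"
      by simp
    moreover have "card {a, b, c, d} \<le> card V"
      using that(1-4) assms(1) by (intro card_mono) auto
    ultimately show False
      using assms(2) by simp
  qed
  then show ?thesis
    using f unfolding one_page_def by blast
qed

text \<open>Induction on the vertex set: a failure of nonseparability at \<open>v\<close> gives two
  smaller sets sharing only \<open>v\<close>, whose orders are glued. Connectedness is not assumed,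
  so the parts need not inherit it.\<close>

lemma one_page_exists:
  assumes "finite V" "theta_free E" "chords_noncrossing E"
  shows "\<exists>f. one_page V E f"
  using assms(1)
proof (induction V rule: finite_psubset_induct)
  case (psubset V)
  consider "card V \<le> 3" | "card V \<ge> 4" "nonseparable V E" | "\<not> nonseparable V E"
    by linarith
  then show ?case
  proof cases
    case 1
    then show ?thesis
      using one_page_le_3 psubset(1) by blast
  next
    case 2
    then show ?thesis
      using Hamiltonian_cycle[OF assms(2)] Hamiltonian_one_page[OF assms(3)] psubset(1) by metis
  next
    case 3
    then obtain v X where v: "v \<in> V" and X: "X \<subseteq> V - {v}" "X \<noteq> {}" "X \<noteq> V - {v}"
      and no: "\<And>x y. x \<in> X \<Longrightarrow> y \<in> V - {v} - X \<Longrightarrow> {x, y} \<notin> E"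
      unfolding nonseparable_def by blast
    define A where "A = insert v X"
    define B where "B = V - X"
    have "A \<subset> V" "B \<subset> V" and AB: "A \<union> B = V" "A \<inter> B = {v}"
      unfolding A_def B_def using v X by auto
    then obtain fA fB where "one_page A E fA" "one_page B E fB"
      using psubset(2) by meson
    moreover have "{x, y} \<subseteq> A \<or> {x, y} \<subseteq> B" if "{x, y} \<in> E" "x \<in> A \<union> B" "y \<in> A \<union> B" for x y
      using that v X(1) no[of x y] no[of y x] unfolding A_def B_def by (auto simp: insert_commute)
    ultimately have "\<exists>f. one_page (A \<union> B) E f"
      using AB(2) psubset(1) unfolding B_def by (intro one_page_glue) auto
    then show ?thesis
      using AB(1) by simp
  qed
qed

section \<open>Colour sets of pieces with two terminals\<close>

text \<open>The components tell which of the residues 0, ..., 4 belong to the set.\<close>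

type_synonym colours = "bool \<times> bool \<times> bool \<times> bool \<times> bool"

definition cs :: "nat list \<Rightarrow> colours" where
  "cs l = (0 \<in> set l, 1 \<in> set l, 2 \<in> set l, 3 \<in> set l, 4 \<in> set l)"

fun col_set :: "colours \<Rightarrow> nat set" where
  "col_set (a, b, c, d, e) = {i. i = 0 \<and> a \<or> i = 1 \<and> b \<or> i = 2 \<and> c \<or> i = 3 \<and> d \<or> i = 4 \<and> e}"

fun join :: "colours \<Rightarrow> colours \<Rightarrow> colours" where
  "join (a, b, c, d, e) (a', b', c', d', e') = (a \<or> a', b \<or> b', c \<or> c', d \<or> d', e \<or> e')"

fun diff :: "colours \<Rightarrow> colours \<Rightarrow> colours" where
  "diff (a, b, c, d, e) (a', b', c', d', e') = (a \<and> \<not> a', b \<and> \<not> b', c \<and> \<not> c', d \<and> \<not> d', e \<and> \<not> e')"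

fun disj :: "colours \<Rightarrow> colours \<Rightarrow> bool" where
  "disj (a, b, c, d, e) (a', b', c', d', e') \<longleftrightarrow>
     \<not> (a \<and> a') \<and> \<not> (b \<and> b') \<and> \<not> (c \<and> c') \<and> \<not> (d \<and> d') \<and> \<not> (e \<and> e')"

text \<open>A set of residues modulo 5 is a cyclic interval iff it contains at most one residue whose
  successor it does not contain.\<close>

fun cyc :: "colours \<Rightarrow> bool" where
  "cyc (a, b, c, d, e) \<longleftrightarrow>
     \<not> (a \<and> \<not> b \<and> c \<and> \<not> d) \<and> \<not> (a \<and> \<not> b \<and> d \<and> \<not> e) \<and> \<not> (b \<and> \<not> c \<and> d \<and> \<not> e) \<and>
     \<not> (b \<and> \<not> c \<and> e \<and> \<not> a) \<and> \<not> (c \<and> \<not> d \<and> e \<and> \<not> a)"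

fun shift :: "colours \<Rightarrow> colours" where
  "shift (a, b, c, d, e) = (e, a, b, c, d)"

fun unshift :: "colours \<Rightarrow> colours" where
  "unshift (a, b, c, d, e) = (b, c, d, e, a)"

fun mirror :: "colours \<Rightarrow> colours" where
  "mirror (a, b, c, d, e) = (a, e, d, c, b)"

type_synonym relation = "(colours \<times> colours) list"

text \<open>A list of pairs represents the relation generated from it by rotations and reflections of the
  residues, and \<open>partners 5 x R\<close> enumerates the second components of the generated pairs
  that start with \<open>x\<close>.\<close>

fun matches :: "colours \<Rightarrow> relation \<Rightarrow> colours list" where
  "matches x [] = []"
| "matches x ((x', y) # R) = (if x' = x then y # matches x R else matches x R)"

fun partners :: "nat \<Rightarrow> colours \<Rightarrow> relation \<Rightarrow> colours list" where
  "partners 0 x R = []"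
| "partners (Suc n) x R =
     matches x R @ map mirror (matches (mirror x) R) @ map shift (partners n (unshift x) R)"

text \<open>The lists below are the result of a computer search. They contain the relations for pieces
  whose terminals are in different components (\<open>split_cells\<close>), for connected pieces without the edge
  between the terminals (\<open>open_cells\<close>) and for pieces with this edge (\<open>closed_cells\<close>). Row \<open>a\<close>,
  column \<open>b - a\<close> belongs to terminals of degrees \<open>a \<le> b\<close>. A tag \<open>Some n\<close> restricts the relation
  to pieces with exactly \<open>n\<close> edges; it singles out the triangle.\<close>

type_synonym cell = "(nat option \<times> (nat list \<times> nat list) list) list"

definition split_cells :: "cell list list" where
  "split_cells = [
    [[(Some 0, [([], [])])],
     [(None, [([], [0])])],
     [(None, [([], [0, 2])])],
     [(None, [([], [0, 1, 2]), ([], [0, 1, 3])])],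
     [(None, [([], [0, 1, 2, 3])])]],
    [[(None, [([0], [2])])],
     [(None, [([0], [0, 2]), ([0], [1, 3])])],
     [(None, [([0], [0, 1, 2]), ([0], [0, 1, 3]), ([0], [1, 2, 3]), ([0], [1, 2, 4])])],
     [(None, [([0], [0, 1, 2, 4])])]],
    [[(None, [([0, 2], [0, 2]), ([0, 2], [0, 3]), ([0, 2], [1, 3])])],
     [(None, [([0, 2], [0, 1, 3]), ([0, 2], [0, 2, 3]), ([0, 2], [1, 2, 3]), ([0, 2], [0, 3, 4])])],
     [(None, [([0, 2], [0, 1, 2, 3]), ([0, 2], [0, 1, 3, 4])])]],
    [[(None, [([0, 1, 2], [1, 2, 3]), ([0, 1, 3], [0, 1, 3]), ([0, 1, 3], [0, 2, 3])])],
     [(None, [([0, 1, 3], [0, 1, 2, 3])])]],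
    [[(None, [([0, 1, 2, 3], [0, 1, 2, 3])])]]]"

definition open_cells :: "cell list list" where
  "open_cells = [
    [[], [], [], [], []],
    [[(Some 2, [([0], [1])]), (None, [([0], [0]), ([0], [2])]), (None, [([0], [1]), ([0], [2])])],
     [(None, [([0], [0, 1]), ([0], [1, 3])])],
     [(None, [([0], [0, 1, 2]), ([0], [0, 1, 3]), ([0], [1, 2, 4])]), (None, [([0], [0, 1, 3]),
        ([0], [0, 2, 3]), ([0], [0, 1, 4]), ([0], [1, 2, 4])])],
     [(None, [([0], [0, 1, 2, 3]), ([0], [0, 1, 2, 4])])]],
    [[(None, [([0, 1], [0, 1]), ([0, 1], [1, 2]), ([0, 1], [0, 3]), ([0, 2], [0, 3]),
       ([0, 2], [1, 3]), ([0, 2], [2, 3])])],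
     [(None, [([0, 1], [0, 1, 2]), ([0, 1], [0, 2, 4]), ([0, 2], [0, 1, 3]),
        ([0, 2], [0, 2, 3]), ([0, 2], [0, 3, 4])])],
     [(None, [([0, 1], [0, 1, 2, 4]), ([0, 2], [0, 1, 2, 3])])]],
    [[(None, [([0, 1, 2], [0, 2, 3]), ([0, 1, 2], [1, 2, 3]), ([0, 1, 3], [0, 1, 3]),
       ([0, 1, 3], [1, 2, 3])]), (None, [([0, 1, 2], [0, 1, 2]), ([0, 1, 2], [0, 2, 3]),
       ([0, 1, 2], [0, 3, 4]), ([0, 1, 3], [1, 2, 3])])],
     [(None, [([0, 1, 2], [0, 1, 2, 3]), ([0, 1, 3], [0, 2, 3, 4])])]],
    [[(None, [([0, 1, 2, 3], [0, 1, 3, 4])])]]]"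

definition closed_cells :: "cell list list" where
  "closed_cells = [
    [[], [], [], [], []],
    [[(Some 1, [([0], [0])])],
     [(None, [([0], [0, 1]), ([0], [0, 2])])],
     [(None, [([0], [0, 1, 3]), ([0], [0, 1, 4])])],
     [(None, [([0], [0, 1, 2, 3]), ([0], [0, 1, 2, 4])])]],
    [[(Some 3, [([0, 1], [0, 2]), ([0, 2], [0, 1]), ([0, 2], [0, 3])]),
       (None, [([0, 1], [1, 2]), ([0, 1], [0, 3]), ([0, 2], [2, 3])])],
     [(None, [([0, 1], [0, 1, 2]), ([0, 1], [0, 2, 4]), ([0, 2], [0, 2, 3]), ([0, 2], [1, 2, 3])])],
     [(None, [([0, 1], [0, 1, 2, 3]), ([0, 1], [0, 1, 2, 4]), ([0, 2], [0, 1, 2, 3])])]],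
    [[(None, [([0, 1, 2], [0, 1, 2]), ([0, 1, 2], [0, 1, 3]), ([0, 1, 3], [0, 1, 2]),
       ([0, 1, 3], [0, 2, 4])])],
     [(None, [([0, 1, 2], [0, 1, 3, 4]), ([0, 1, 3], [0, 1, 2, 3])])]],
    [[(None, [([0, 1, 2, 3], [0, 1, 2, 3])])]]]"

fun decode :: "nat option \<times> (nat list \<times> nat list) list \<Rightarrow> nat option \<times> relation" where
  "decode (m, R) = (m, map (map_prod cs cs) R)"

fun flip :: "nat option \<times> relation \<Rightarrow> nat option \<times> relation" where
  "flip (m, R) = (m, map prod.swap R)"

text \<open>Terminals with degrees in decreasing order use the transposed entries; the checks below
  cover both orders.\<close>

definition triangular :: "cell list list \<Rightarrow> nat \<Rightarrow> nat \<Rightarrow> (nat option \<times> relation) list" where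
  "triangular T a b = (if a \<le> b then map decode (T ! a ! (b - a)) else map (flip \<circ> decode) (T ! b ! (a - b)))"

definition relations :: "bool \<Rightarrow> bool \<Rightarrow> nat \<Rightarrow> nat \<Rightarrow> (nat option \<times> relation) list" where
  "relations k c a b = triangular (if k then closed_cells else if c then open_cells else split_cells) a b"

text \<open>The checks use \<open>if\<close> instead of the connectives because the simplifier, as an evaluator,
  does not descend into the branches before the condition has been decided.\<close>

fun some_in :: "('b \<Rightarrow> bool) \<Rightarrow> 'b list \<Rightarrow> bool" where
  "some_in P [] = False"
| "some_in P (x # xs) = (if P x then True else some_in P xs)"

fun all_in :: "('b \<Rightarrow> bool) \<Rightarrow> 'b list \<Rightarrow> bool" where
  "all_in P [] = True"
| "all_in P (x # xs) = (if P x then all_in P xs else False)"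

text \<open>Tags are edge counts and add up. A tagged target needs both sources tagged; an untagged
  one promises nothing about the number of edges.\<close>

fun tag_ok :: "nat option \<Rightarrow> nat option \<Rightarrow> nat option \<Rightarrow> bool" where
  "tag_ok None m n = True"
| "tag_ok (Some l) (Some m) (Some n) = (l = m + n)"
| "tag_ok (Some l) m n = False"

fun joinable :: "colours \<Rightarrow> colours \<Rightarrow> bool" where
  "joinable y z = (if disj y z then cyc (join y z) else False)"

fun joinable_in :: "colours list \<Rightarrow> colours \<Rightarrow> bool" where
  "joinable_in Z y = some_in (joinable y) Z"

text \<open>\<open>x\<close> and \<open>t\<close> are the sets at the outer terminals. The shared
  vertex becomes an inner one, so its two sets must be disjoint with a cyclic interval as union.
  \<open>Q\<close> is expected with swapped components, so that its lookup can start from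
  \<open>t\<close>.\<close>

fun gluable :: "relation \<Rightarrow> relation \<Rightarrow> colours \<times> colours \<Rightarrow> bool" where
  "gluable P Q (x, t) = some_in (joinable_in (partners 5 t Q)) (partners 5 x P)"

text \<open>\<open>s\<close> is the colour of the new edge; it must occur at both terminals, and
  what is left after removing it must be realized by the piece before closing.\<close>

fun closable_by :: "relation \<Rightarrow> colours \<Rightarrow> colours \<Rightarrow> colours \<Rightarrow> bool" where
  "closable_by P x y s = (if join s (diff x s) = x \<and> join s (diff y s) = y
     then some_in ((=) (diff y s)) (partners 5 (diff x s) P) else False)"

fun closable :: "relation \<Rightarrow> colours \<times> colours \<Rightarrow> bool" where
  "closable P (x, y) = some_in (closable_by P x y) [cs [0], cs [1], cs [2], cs [3], cs [4]]"

fun series_into :: "nat option \<Rightarrow> relation \<Rightarrow> nat option \<Rightarrow> relation \<Rightarrow> nat option \<times> relation \<Rightarrow> bool" where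
  "series_into m P m' Q (n, R) = (if tag_ok n m m' then all_in (gluable P Q) R else False)"

text \<open>The target relation may depend on the two source relations, but then all its generators
  must be obtained; symmetry takes care of the pairs generated from them.\<close>

fun series_of :: "(nat option \<times> relation) list \<Rightarrow> nat option \<times> relation \<Rightarrow> nat option \<times> relation \<Rightarrow> bool" where
  "series_of T (m, P) (m', Q) = some_in (series_into m P m' (map prod.swap Q)) T"

fun series_all :: "(nat option \<times> relation) list \<Rightarrow> (nat option \<times> relation) list \<Rightarrow> nat option \<times> relation \<Rightarrow> bool" where
  "series_all T S e = all_in (series_of T e) S"

text \<open>The left factor of a series join is either the bare gap or a closed piece, so a single
  flag \<open>k\<close> describes it.\<close>

fun series_ok :: "bool \<Rightarrow> nat \<Rightarrow> nat \<Rightarrow> bool \<Rightarrow> bool \<Rightarrow> nat \<Rightarrow> nat \<Rightarrow> bool" where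
  "series_ok k a b k' c' a' b' =
     all_in (series_all (relations False (k \<and> c') a b') (relations k' c' a' b')) (relations k k a b)"

text \<open>The condition skips what cannot occur: a gap followed by a disconnected piece (three
  components), adjacent terminals in a disconnected piece, and a shared vertex of degree above
  4.\<close>

fun series_right :: "bool \<Rightarrow> nat \<Rightarrow> nat \<Rightarrow> bool \<times> bool \<times> nat \<Rightarrow> bool" where
  "series_right k a b (k', c', a') =
     (if (k \<or> c') \<and> (c' \<or> \<not> k') \<and> b + a' \<le> 4 then all_in (series_ok k a b k' c' a') [0, 1, 2, 3, 4] else True)"

fun series_left :: "bool \<times> nat \<times> nat \<Rightarrow> bool" where
  "series_left (k, a, b) =
     all_in (series_right k a b) (List.product [True, False] (List.product [True, False] [0, 1, 2, 3, 4]))"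

text \<open>\<open>(False, 0, 0)\<close> is the bare gap; terminals of closed pieces have degree at
  least 1.\<close>

lemma series_check:
  "all_in series_left ((False, 0, 0) # List.product [True] (List.product [1, 2, 3, 4] [1, 2, 3, 4]))"
  by code_simp

fun close_into :: "nat option \<Rightarrow> relation \<Rightarrow> nat option \<times> relation \<Rightarrow> bool" where
  "close_into m P (n, R) = (if tag_ok n m (Some 1) then all_in (closable P) R else False)"

fun close_of :: "(nat option \<times> relation) list \<Rightarrow> nat option \<times> relation \<Rightarrow> bool" where
  "close_of T (m, P) = some_in (close_into m P) T"

fun close_ok :: "bool \<times> nat \<times> nat \<Rightarrow> bool" where
  "close_ok (c, a, b) = all_in (close_of (relations True True (a + 1) (b + 1))) (relations False c a b)"

text \<open>Degrees stop at 3 because closing raises both by one.\<close>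

lemma close_check: "all_in close_ok (List.product [True, False] (List.product [0, 1, 2, 3] [0, 1, 2, 3]))"
  by code_simp

fun both_cyc :: "colours \<times> colours \<Rightarrow> bool" where
  "both_cyc (x, y) = (if cyc x then cyc y else False)"

text \<open>Tag \<open>Some 3\<close> is exempt: the triangle would need three residues that are
  pairwise neighbours modulo 5.\<close>

fun final_of :: "nat option \<times> relation \<Rightarrow> bool" where
  "final_of (m, R) = (if m = Some 3 then True else some_in both_cyc R)"

fun final_ok :: "bool \<times> nat \<times> nat \<Rightarrow> bool" where
  "final_ok (k, a, b) = all_in final_of (relations k True a b)"

lemma final_check: "all_in final_ok (List.product [True, False] (List.product [0, 1, 2, 3, 4] [0, 1, 2, 3, 4]))"
  by code_simp

section \<open>Meaning of the checks and of the encoded colour sets\<close>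

lemma some_in_iff: "some_in P xs \<longleftrightarrow> (\<exists>x\<in>set xs. P x)"
  by (induction xs) auto

lemma all_in_iff: "all_in P xs \<longleftrightarrow> (\<forall>x\<in>set xs. P x)"
  by (induction xs) auto

lemma gluableD:
  assumes "gluable P Q (x, t)"
  obtains y z where "y \<in> set (partners 5 x P)" "z \<in> set (partners 5 t Q)" "disj y z" "cyc (join y z)"
  using assms by (auto simp: some_in_iff split: if_splits)

lemma closableD:
  assumes "closable P (x, y)"
  obtains x' y' i where "y' \<in> set (partners 5 x' P)" "i < 5" "disj (cs [i]) x'" "disj (cs [i]) y'"
    "x = join (cs [i]) x'" "y = join (cs [i]) y'"
proof -
  have diff: "disj s (diff z s)" for s z
    by (cases s; cases z) auto
  obtain s where s: "s \<in> set (map (\<lambda>i. cs [i]) [0, 1, 2, 3, 4])" "join s (diff x s) = x"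
    "join s (diff y s) = y" "diff y s \<in> set (partners 5 (diff x s) P)"
    using assms unfolding closable.simps closable_by.simps some_in_iff list.map by (metis (full_types))
  then obtain i where "i \<in> set [0, 1, 2, 3, 4::nat]" "s = cs [i]"
    unfolding set_map by blast
  moreover have "i < 5"
    using calculation(1) by auto
  ultimately show ?thesis
    using s diff that by metis
qed

text \<open>As a union over the five components, the set lets images distribute.\<close>

lemma col_set_if:
  "col_set (a, b, c, d, e) = (if a then {0} else {}) \<union> (if b then {1} else {}) \<union>
     (if c then {2} else {}) \<union> (if d then {3} else {}) \<union> (if e then {4} else {})"
  by auto

lemma col_set_join: "col_set (join x y) = col_set x \<union> col_set y"
  by (cases x; cases y) auto

lemma col_set_disj: "disj x y \<Longrightarrow> col_set x \<inter> col_set y = {}"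
  by (cases x; cases y) auto

lemma col_set_cs: "i < 5 \<Longrightarrow> col_set (cs [i]) = {i}"
  unfolding cs_def by auto

lemma col_set_empty: "col_set (cs []) = {}"
  unfolding cs_def by auto

lemma col_set_shift: "col_set (shift x) = (\<lambda>i. Suc i mod 5) ` col_set x"
  by (cases x) (simp only: shift.simps col_set_if image_Un if_distrib[of "image _"] image_insert image_empty, auto)

lemma col_set_mirror: "col_set (mirror x) = (\<lambda>i. (5 - i) mod 5) ` col_set x"
  by (cases x) (simp only: mirror.simps col_set_if image_Un if_distrib[of "image _"] image_insert image_empty, auto)

lemma cyc_shift: "cyc (shift x) = cyc x"
  by (cases x) auto

lemma cyc_mirror: "cyc (mirror x) = cyc x"
  by (cases x) auto

section \<open>Realizable pairs under symmetries and the two operations\<close>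

text \<open>Only inner vertices have to see cyclic intervals; the terminal sets are prescribed
  exactly, because edges may still be added there.\<close>

definition realizable :: "'a set set \<Rightarrow> 'a \<Rightarrow> 'a \<Rightarrow> colours \<times> colours \<Rightarrow> bool" where
  "realizable F u v xy \<longleftrightarrow> (\<exists>\<alpha>. (\<forall>e\<in>F. \<alpha> e < 5) \<and>
     (\<forall>e\<in>F. \<forall>e'\<in>F. e \<noteq> e' \<and> e \<inter> e' \<noteq> {} \<longrightarrow> \<alpha> e \<noteq> \<alpha> e') \<and>
     (\<forall>w\<in>\<Union> F - {u, v}. \<exists>z. cyc z \<and> spectrum F \<alpha> w = col_set z) \<and>
     spectrum F \<alpha> u = col_set (fst xy) \<and> spectrum F \<alpha> v = col_set (snd xy))"

text \<open>A colouring is composed with a permutation of the residues that preserves cyclic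
  intervals.\<close>

lemma realizable_map:
  assumes real: "realizable F u v (x, y)"
    and inj: "inj_on \<sigma> {..<5}" and range: "\<And>i. i < 5 \<Longrightarrow> \<sigma> i < 5"
    and s: "\<And>z. col_set (s z) = \<sigma> ` col_set z" "\<And>z. cyc (s z) = cyc z"
  shows "realizable F u v (s x, s y)"
proof -
  obtain \<alpha> where \<alpha>: "\<forall>e\<in>F. \<alpha> e < 5"
    "\<forall>e\<in>F. \<forall>e'\<in>F. e \<noteq> e' \<and> e \<inter> e' \<noteq> {} \<longrightarrow> \<alpha> e \<noteq> \<alpha> e'"
    "\<forall>w\<in>\<Union> F - {u, v}. \<exists>z. cyc z \<and> spectrum F \<alpha> w = col_set z"
    "spectrum F \<alpha> u = col_set x" "spectrum F \<alpha> v = col_set y"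
    using real unfolding realizable_def by auto
  have sp: "spectrum F (\<sigma> \<circ> \<alpha>) w = \<sigma> ` spectrum F \<alpha> w" for w
    unfolding spectrum_def by (simp add: image_comp)
  have "\<forall>e\<in>F. (\<sigma> \<circ> \<alpha>) e < 5"
    using \<alpha>(1) range by simp
  moreover have "\<forall>e\<in>F. \<forall>e'\<in>F. e \<noteq> e' \<and> e \<inter> e' \<noteq> {} \<longrightarrow> (\<sigma> \<circ> \<alpha>) e \<noteq> (\<sigma> \<circ> \<alpha>) e'"
    using \<alpha>(1,2) inj by (simp add: inj_on_eq_iff)
  moreover have "\<forall>w\<in>\<Union> F - {u, v}. \<exists>z. cyc z \<and> spectrum F (\<sigma> \<circ> \<alpha>) w = col_set z"
    using \<alpha>(3) s unfolding sp by metis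
  ultimately show ?thesis
    using \<alpha>(4,5) s(1) unfolding realizable_def sp by (intro exI[of _ "\<sigma> \<circ> \<alpha>"]) (simp add: sp)
qed

lemma realizable_shift: "realizable F u v (x, y) \<Longrightarrow> realizable F u v (shift x, shift y)"
  by (rule realizable_map[where \<sigma> = "\<lambda>i. Suc i mod 5"])
    (auto simp: inj_on_def lessThan_nat_numeral lessThan_Suc col_set_shift cyc_shift)

lemma realizable_mirror: "realizable F u v (x, y) \<Longrightarrow> realizable F u v (mirror x, mirror y)"
  by (rule realizable_map[where \<sigma> = "\<lambda>i. (5 - i) mod 5"])
    (auto simp: inj_on_def lessThan_nat_numeral lessThan_Suc col_set_mirror cyc_mirror)

lemma realizable_commute: "realizable F u v (x, y) = realizable F v u (y, x)"
  unfolding realizable_def by (auto simp: insert_commute)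

lemma realizable_partners:
  assumes "\<And>xy. xy \<in> set R \<Longrightarrow> realizable F u v xy" "y \<in> set (partners n x R)"
  shows "realizable F u v (x, y)"
proof -
  have matches: "y \<in> set (matches x R) \<longleftrightarrow> (x, y) \<in> set R" for x y
    by (induction x R rule: matches.induct) auto
  have inverse: "mirror (mirror z) = z" "shift (unshift z) = z" for z
    by (cases z; simp)+
  show ?thesis
    using assms(2)
  proof (induction n arbitrary: x y)
    case (Suc n)
    then consider "(x, y) \<in> set R" | z where "(mirror x, z) \<in> set R" "y = mirror z"
      | z where "z \<in> set (partners n (unshift x) R)" "y = shift z"
      by (auto simp: matches)
    then show ?case
    proof cases
      case 1
      then show ?thesis
        by (rule assms(1))
    next
      case 2
      then show ?thesis
        using realizable_mirror[OF assms(1)[OF 2(1)]] by (simp add: inverse)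
    next
      case 3
      then show ?thesis
        using realizable_shift[OF Suc.IH[OF 3(1)]] by (simp add: inverse)
    qed
  qed simp
qed

text \<open>The edge sets are disjoint and share at most the vertex \<open>w\<close>, so the two
  colourings can be merged and interact only there.\<close>

lemma realizable_series:
  assumes F: "realizable F u w (x, y)" and H: "realizable H w v (z, t)"
    and yz: "disj y z" "cyc (join y z)"
    and meet: "\<Union> F \<inter> \<Union> H \<subseteq> {w}" and uv: "u \<notin> \<Union> H" "v \<notin> \<Union> F"
    and two: "\<And>e. e \<in> F \<Longrightarrow> card e = 2"
  shows "realizable (F \<union> H) u v (x, t)"
proof -
  obtain \<alpha> where \<alpha>: "\<forall>e\<in>F. \<alpha> e < 5"
    "\<forall>e\<in>F. \<forall>e'\<in>F. e \<noteq> e' \<and> e \<inter> e' \<noteq> {} \<longrightarrow> \<alpha> e \<noteq> \<alpha> e'"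
    "\<forall>p\<in>\<Union> F - {u, w}. \<exists>z. cyc z \<and> spectrum F \<alpha> p = col_set z"
    "spectrum F \<alpha> u = col_set x" "spectrum F \<alpha> w = col_set y"
    using F unfolding realizable_def by auto
  obtain \<beta> where \<beta>: "\<forall>e\<in>H. \<beta> e < 5"
    "\<forall>e\<in>H. \<forall>e'\<in>H. e \<noteq> e' \<and> e \<inter> e' \<noteq> {} \<longrightarrow> \<beta> e \<noteq> \<beta> e'"
    "\<forall>p\<in>\<Union> H - {w, v}. \<exists>z. cyc z \<and> spectrum H \<beta> p = col_set z"
    "spectrum H \<beta> w = col_set z" "spectrum H \<beta> v = col_set t"
    using H unfolding realizable_def by auto
  have FH: "F \<inter> H = {}"
    using disjoint_edge_sets[OF two meet] by blast
  define \<gamma> where "\<gamma> e = (if e \<in> F then \<alpha> e else \<beta> e)" for e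
  have F\<gamma>: "\<gamma> e = \<alpha> e" if "e \<in> F" for e
    using that by (simp add: \<gamma>_def)
  have H\<gamma>: "\<gamma> e = \<beta> e" if "e \<in> H" for e
    using that FH by (auto simp: \<gamma>_def)
  have sp: "spectrum (F \<union> H) \<gamma> p = spectrum F \<alpha> p \<union> spectrum H \<beta> p" for p
    unfolding spectrum_def incident_edges_def using F\<gamma> H\<gamma> by (auto simp: image_iff) metis+
  have empty: "p \<notin> \<Union> K \<Longrightarrow> spectrum K \<delta> p = {}" for p K and \<delta> :: "'a set \<Rightarrow> nat"
    unfolding spectrum_def incident_edges_def by auto
  have disj: "col_set y \<inter> col_set z = {}"
    using yz(1) by (rule col_set_disj)
  have mixed: "\<alpha> e \<noteq> \<beta> e'" if "e \<in> F" "e' \<in> H" "e \<inter> e' \<noteq> {}" for e e'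
  proof -
    have "w \<in> e" "w \<in> e'"
      using that meet by blast+
    then have "\<alpha> e \<in> spectrum F \<alpha> w" "\<beta> e' \<in> spectrum H \<beta> w"
      using that unfolding spectrum_def incident_edges_def by auto
    then show ?thesis
      using disj \<alpha>(5) \<beta>(4) by auto
  qed
  have "\<forall>e\<in>F \<union> H. \<gamma> e < 5"
    using \<alpha>(1) \<beta>(1) F\<gamma> H\<gamma> by auto
  moreover have "\<gamma> e \<noteq> \<gamma> e'" if ee': "e \<in> F \<union> H" "e' \<in> F \<union> H" "e \<noteq> e'" "e \<inter> e' \<noteq> {}" for e e'
  proof -
    consider "e \<in> F" "e' \<in> F" | "e \<in> H" "e' \<in> H" | "e \<in> F" "e' \<in> H" | "e \<in> H" "e' \<in> F"
      using ee' by blast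
    then show ?thesis
    proof cases
      case 1
      then show ?thesis
        using \<alpha>(2) F\<gamma> ee'(3,4) by simp
    next
      case 2
      then show ?thesis
        using \<beta>(2) H\<gamma> ee'(3,4) by simp
    next
      case 3
      then show ?thesis
        using mixed[of e e'] F\<gamma> H\<gamma> ee'(4) by simp
    next
      case 4
      then show ?thesis
        using mixed[of e' e] F\<gamma> H\<gamma> ee'(4) by (simp add: Int_commute)
    qed
  qed
  moreover have "\<exists>z. cyc z \<and> spectrum (F \<union> H) \<gamma> p = col_set z" if p: "p \<in> \<Union> (F \<union> H) - {u, v}" for p
  proof -
    consider "p = w" | "p \<in> \<Union> F" "p \<noteq> w" | "p \<in> \<Union> H" "p \<noteq> w"
      using p by blast
    then show ?thesis
    proof cases
      case 1
      then show ?thesis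
        using sp[of w] \<alpha>(5) \<beta>(4) yz(2) col_set_join by metis
    next
      case 2
      then have "spectrum (F \<union> H) \<gamma> p = spectrum F \<alpha> p"
        using sp[of p] empty[of p H \<beta>] meet by blast
      then show ?thesis
        using \<alpha>(3) 2 p by (metis DiffD2 DiffI insertCI insertE singletonD)
    next
      case 3
      then have "spectrum (F \<union> H) \<gamma> p = spectrum H \<beta> p"
        using sp[of p] empty[of p F \<alpha>] meet by blast
      then show ?thesis
        using \<beta>(3) 3 p by (metis DiffD2 DiffI insertCI insertE singletonD)
    qed
  qed
  moreover have "spectrum (F \<union> H) \<gamma> u = col_set x" "spectrum (F \<union> H) \<gamma> v = col_set t"
    using sp empty[OF uv(1)] empty[OF uv(2)] \<alpha>(4) \<beta>(5) by auto
  ultimately show ?thesis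
    unfolding realizable_def by (intro exI[of _ \<gamma>]) auto
qed

text \<open>The colour \<open>i\<close> is missing at both terminals, so the new edge can take it;
  no inner vertex is affected.\<close>

lemma realizable_close:
  assumes F: "realizable F u v (x, y)" and new: "{u, v} \<notin> F"
    and i: "i < 5" "disj (cs [i]) x" "disj (cs [i]) y"
  shows "realizable (insert {u, v} F) u v (join (cs [i]) x, join (cs [i]) y)"
proof -
  obtain \<alpha> where \<alpha>: "\<forall>e\<in>F. \<alpha> e < 5"
    "\<forall>e\<in>F. \<forall>e'\<in>F. e \<noteq> e' \<and> e \<inter> e' \<noteq> {} \<longrightarrow> \<alpha> e \<noteq> \<alpha> e'"
    "\<forall>p\<in>\<Union> F - {u, v}. \<exists>z. cyc z \<and> spectrum F \<alpha> p = col_set z"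
    "spectrum F \<alpha> u = col_set x" "spectrum F \<alpha> v = col_set y"
    using F unfolding realizable_def by auto
  define \<gamma> where "\<gamma> = \<alpha>({u, v} := i)"
  have \<gamma>: "\<gamma> {u, v} = i" "\<And>e. e \<in> F \<Longrightarrow> \<gamma> e = \<alpha> e"
    using new by (auto simp: \<gamma>_def)
  have sp: "spectrum (insert {u, v} F) \<gamma> p = (if p \<in> {u, v} then {i} else {}) \<union> spectrum F \<alpha> p" for p
    unfolding spectrum_def incident_edges_def using \<gamma> by (auto simp: image_iff) metis+
  have "i \<notin> col_set x" "i \<notin> col_set y"
    using col_set_disj[OF i(2)] col_set_disj[OF i(3)] col_set_cs[OF i(1)] by auto
  then have fresh: "\<alpha> e \<noteq> i" if "e \<in> F" "e \<inter> {u, v} \<noteq> {}" for e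
    using that \<alpha>(4,5) unfolding spectrum_def incident_edges_def by blast
  have "\<forall>e\<in>insert {u, v} F. \<gamma> e < 5"
    using \<alpha>(1) \<gamma> i(1) by auto
  moreover have "\<gamma> e \<noteq> \<gamma> e'"
    if ee': "e \<in> insert {u, v} F" "e' \<in> insert {u, v} F" "e \<noteq> e'" "e \<inter> e' \<noteq> {}" for e e'
  proof -
    consider "e \<in> F" "e' \<in> F" | "e = {u, v}" "e' \<in> F" | "e \<in> F" "e' = {u, v}"
      using ee' by blast
    then show ?thesis
    proof cases
      case 1
      then show ?thesis
        using \<alpha>(2) \<gamma>(2) ee'(3,4) by simp
    next
      case 2
      then show ?thesis
        using \<gamma> fresh[of e'] ee'(4) by (simp add: Int_commute)
    next
      case 3
      then show ?thesis
        using \<gamma> fresh[of e] ee'(4) by simp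
    qed
  qed
  moreover have "\<exists>z. cyc z \<and> spectrum (insert {u, v} F) \<gamma> p = col_set z"
    if "p \<in> \<Union> (insert {u, v} F) - {u, v}" for p
    using that \<alpha>(3) sp[of p] by auto
  moreover have "spectrum (insert {u, v} F) \<gamma> u = col_set (join (cs [i]) x)"
    "spectrum (insert {u, v} F) \<gamma> v = col_set (join (cs [i]) y)"
    using sp \<alpha>(4,5) col_set_cs[OF i(1)] by (simp_all add: col_set_join)
  ultimately show ?thesis
    unfolding realizable_def by (intro exI[of _ \<gamma>]) auto
qed

text \<open>In \<open>piece k c U F u v\<close> the flag \<open>k\<close> says that the terminals are adjacent; \<open>c\<close> says that the
  graph is connected, and if it does not hold there are two components, one for each terminal.\<close>

inductive piece :: "bool \<Rightarrow> bool \<Rightarrow> 'a set \<Rightarrow> 'a set set \<Rightarrow> 'a \<Rightarrow> 'a \<Rightarrow> bool" where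
  gap: "u \<noteq> v \<Longrightarrow> piece False False {u, v} {} u v"
| close: "piece False c U F u v \<Longrightarrow> piece True True U (insert {u, v} F) u v"
| gap_series: "piece k True W H w v \<Longrightarrow> u \<notin> W \<Longrightarrow> piece False False (insert u W) H u v"
| closed_series: "piece True True U F u w \<Longrightarrow> piece k c W H w v \<Longrightarrow> U \<inter> W = {w} \<Longrightarrow>
    piece False c (U \<union> W) (F \<union> H) u v"

lemma piece_facts:
  "piece k c U F u v \<Longrightarrow> u \<in> U \<and> v \<in> U \<and> u \<noteq> v \<and> finite F \<and> (\<forall>e\<in>F. e \<subseteq> U \<and> card e = 2) \<and>
     {u, v} \<in> F = k \<and> (k \<longrightarrow> c)"
proof (induction rule: piece.induct)
  case (gap_series k W H w v u)
  then show ?case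
    by blast
next
  case (closed_series U F u w k c W H v)
  then have "v \<notin> U" "u \<notin> W"
    by auto
  then have "{u, v} \<notin> F" "{u, v} \<notin> H"
    using closed_series.IH by (meson insert_subset)+
  then show ?case
    using closed_series.IH closed_series.hyps(3) by auto
qed auto

section \<open>Every piece realizes an entry of the tables\<close>

text \<open>The invariant of the induction over \<open>piece\<close>: a cell is a disjunction of its
  relations, and a relation is a conjunction of its generating pairs.\<close>

definition coloured :: "bool \<Rightarrow> bool \<Rightarrow> 'a set set \<Rightarrow> 'a \<Rightarrow> 'a \<Rightarrow> bool" where
  "coloured k c F u v \<longleftrightarrow>
     (\<exists>(m, R)\<in>set (relations k c (card (incident_edges F u)) (card (incident_edges F v))).
        (\<forall>n. m = Some n \<longrightarrow> card F = n) \<and> (\<forall>xy\<in>set R. realizable F u v xy))"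

lemma tag_okD: "tag_ok n m m' \<Longrightarrow> n = Some l \<Longrightarrow> \<exists>i j. m = Some i \<and> m' = Some j \<and> l = i + j"
  by (cases m; cases m') auto

lemma relations_gap: "relations False False 0 0 = [(Some 0, [(cs [], cs [])])]"
  by code_simp

lemma coloured_gap: "coloured False False {} u v"
proof -
  have "realizable {} u v (cs [], cs [])"
    unfolding realizable_def spectrum_def incident_edges_def by (simp add: col_set_empty)
  then show ?thesis
    unfolding coloured_def incident_edges_def by (simp add: relations_gap)
qed

lemma coloured_close:
  assumes "coloured False c F u v" and new: "{u, v} \<notin> F" "u \<noteq> v" and fin: "finite F"
    and deg: "card (incident_edges (insert {u, v} F) u) \<le> 4" "card (incident_edges (insert {u, v} F) v) \<le> 4"
  shows "coloured True True (insert {u, v} F) u v"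
proof -
  let ?a = "card (incident_edges F u)" and ?b = "card (incident_edges F v)"
  have inc: "incident_edges (insert {u, v} F) u = insert {u, v} (incident_edges F u)"
    "incident_edges (insert {u, v} F) v = insert {u, v} (incident_edges F v)"
    unfolding incident_edges_def by auto
  have card: "card (incident_edges (insert {u, v} F) u) = ?a + 1"
    "card (incident_edges (insert {u, v} F) v) = ?b + 1"
    unfolding inc using new(1) fin by (simp_all add: incident_edges_def)
  obtain m P where P: "(m, P) \<in> set (relations False c ?a ?b)"
    "\<And>n. m = Some n \<Longrightarrow> card F = n" "\<And>xy. xy \<in> set P \<Longrightarrow> realizable F u v xy"
    using assms(1) unfolding coloured_def by blast
  have "c \<in> set [True, False]" "?a \<in> set [0, 1, 2, 3]" "?b \<in> set [0, 1, 2, 3]"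
    using deg unfolding card by auto
  then have "(c, ?a, ?b) \<in> set (List.product [True, False] (List.product [0, 1, 2, 3] [0, 1, 2, 3]))"
    unfolding set_product by (intro SigmaI)
  then have "close_ok (c, ?a, ?b)"
    using close_check[unfolded all_in_iff] by (rule bspec[rotated])
  then obtain n R where R: "(n, R) \<in> set (relations True True (?a + 1) (?b + 1))"
    "tag_ok n m (Some 1)" "\<And>xy. xy \<in> set R \<Longrightarrow> closable P xy"
  proof -
    have "close_of (relations True True (?a + 1) (?b + 1)) (m, P)"
      using P(1) \<open>close_ok (c, ?a, ?b)\<close> unfolding close_ok.simps all_in_iff by blast
    then show ?thesis
      using that unfolding close_of.simps some_in_iff
      by (metis (no_types, opaque_lifting) all_in_iff close_into.simps prod.exhaust)
  qed
  have "realizable (insert {u, v} F) u v (x, y)" if xy: "(x, y) \<in> set R" for x y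
  proof -
    obtain x' y' i where "y' \<in> set (partners 5 x' P)" "i < 5" "disj (cs [i]) x'" "disj (cs [i]) y'"
      "x = join (cs [i]) x'" "y = join (cs [i]) y'"
      using R(3)[OF xy] by (rule closableD)
    then show ?thesis
      using realizable_close[OF realizable_partners[OF P(3)] new(1)] by blast
  qed
  moreover have "card (insert {u, v} F) = l" if "n = Some l" for l
    using tag_okD[OF R(2) that] P(2) new(1) fin by auto
  ultimately show ?thesis
    unfolding coloured_def card using R(1) by (intro bexI[of _ "(n, R)"]) auto
qed

text \<open>This serves both series rules of \<open>piece\<close>: \<open>k\<close> true is a closed
  left factor, \<open>k\<close> false the bare gap with \<open>F = {}\<close>.\<close>

lemma coloured_series:
  assumes F: "coloured k c F u w" and H: "coloured k' c' H w v" and kc: "k \<longrightarrow> c" "\<not> k \<longrightarrow> \<not> c"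
    and left: "k \<or> F = {}" and right: "k \<or> c'" "k' \<longrightarrow> c'"
    and meet: "\<Union> F \<inter> \<Union> H \<subseteq> {w}" and uv: "u \<notin> \<Union> H" "v \<notin> \<Union> F"
    and two: "\<And>e. e \<in> F \<Longrightarrow> card e = 2" and fin: "finite F" "finite H"
    and closed: "k \<Longrightarrow> {u, w} \<in> F"
    and deg: "\<And>p. card (incident_edges (F \<union> H) p) \<le> 4"
  shows "coloured False (k \<and> c') (F \<union> H) u v"
proof -
  let ?a = "card (incident_edges F u)" and ?b = "card (incident_edges F w)"
  let ?a' = "card (incident_edges H w)" and ?b' = "card (incident_edges H v)"
  have FH: "F \<inter> H = {}"
    using disjoint_edge_sets[OF two meet] by blast
  have inc: "incident_edges (F \<union> H) p = incident_edges F p \<union> incident_edges H p" for p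
    unfolding incident_edges_def by auto
  have fin': "finite (incident_edges F p)" "finite (incident_edges H p)" for p
    using fin unfolding incident_edges_def by auto
  have "incident_edges H u = {}" "incident_edges F v = {}"
    using uv unfolding incident_edges_def by auto
  then have card: "card (incident_edges (F \<union> H) u) = ?a" "card (incident_edges (F \<union> H) v) = ?b'"
    unfolding inc by auto
  have "card (incident_edges (F \<union> H) w) = ?b + ?a'"
    unfolding inc using fin' FH by (intro card_Un_disjoint) (auto simp: incident_edges_def)
  then have le: "?b + ?a' \<le> 4" "?a \<le> 4" "?b' \<le> 4"
    using deg[of w] deg[of u] deg[of v] card by auto
  obtain m P where P: "(m, P) \<in> set (relations k k ?a ?b)"
    "\<And>n. m = Some n \<Longrightarrow> card F = n" "\<And>xy. xy \<in> set P \<Longrightarrow> realizable F u w xy"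
    using F kc unfolding coloured_def by (cases k) auto
  obtain m' Q where Q: "(m', Q) \<in> set (relations k' c' ?a' ?b')"
    "\<And>n. m' = Some n \<Longrightarrow> card H = n" "\<And>xy. xy \<in> set Q \<Longrightarrow> realizable H w v xy"
    using H unfolding coloured_def by blast
  have "(k, ?a, ?b) \<in> set ((False, 0, 0) # List.product [True] (List.product [1, 2, 3, 4] [1, 2, 3, 4]))"
  proof (cases k)
    case True
    then have "{u, w} \<in> incident_edges F u" "{u, w} \<in> incident_edges F w"
      using closed unfolding incident_edges_def by auto
    then have "?a \<noteq> 0" "?b \<noteq> 0"
      using fin' by auto
    then have "?a \<in> set [1, 2, 3, 4]" "?b \<in> set [1, 2, 3, 4]"
      using le by auto
    then show ?thesis
      using True unfolding set_product list.set by blast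
  next
    case False
    then show ?thesis
      using left unfolding incident_edges_def by simp
  qed
  then have "series_left (k, ?a, ?b)"
    using series_check[unfolded all_in_iff] by (rule bspec[rotated])
  moreover have "k' \<in> set [True, False]" "c' \<in> set [True, False]" "?a' \<in> set [0, 1, 2, 3, 4]"
    using le by auto
  then have "(k', c', ?a') \<in> set (List.product [True, False] (List.product [True, False] [0, 1, 2, 3, 4]))"
    unfolding set_product by (intro SigmaI)
  ultimately have "series_right k ?a ?b (k', c', ?a')"
    unfolding series_left.simps all_in_iff by blast
  moreover have "?b' \<in> set [0, 1, 2, 3, 4]"
    using le by auto
  moreover have "all_in (series_ok k ?a ?b k' c' ?a') [0, 1, 2, 3, 4]" if "series_right k ?a ?b (k', c', ?a')"
    using that right(1,2) le(1) unfolding series_right.simps by (auto split: if_splits)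
  ultimately have "series_ok k ?a ?b k' c' ?a' ?b'"
    unfolding all_in_iff by blast
  then have "series_of (relations False (k \<and> c') ?a ?b') (m, P) (m', Q)"
    using P(1) Q(1) unfolding series_ok.simps series_all.simps all_in_iff by blast
  then obtain n R where R: "(n, R) \<in> set (relations False (k \<and> c') ?a ?b')"
    "tag_ok n m m'" "\<And>xy. xy \<in> set R \<Longrightarrow> gluable P (map prod.swap Q) xy"
    unfolding series_of.simps some_in_iff
    by (metis (no_types, opaque_lifting) all_in_iff series_into.simps prod.exhaust)
  have Q': "realizable H v w xy" if "xy \<in> set (map prod.swap Q)" for xy
    using that Q(3) realizable_commute by fastforce
  have "realizable (F \<union> H) u v (x, t)" if xt: "(x, t) \<in> set R" for x t
  proof -
    obtain y z where yz: "y \<in> set (partners 5 x P)" "z \<in> set (partners 5 t (map prod.swap Q))"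
      "disj y z" "cyc (join y z)"
      using R(3)[OF xt] by (rule gluableD)
    have "realizable F u w (x, y)"
      using P(3) yz(1) by (rule realizable_partners)
    moreover have "realizable H w v (z, t)"
      using realizable_partners[OF Q' yz(2)] realizable_commute by metis
    ultimately show ?thesis
      using yz(3,4) meet uv two by (rule realizable_series)
  qed
  moreover have "card (F \<union> H) = l" if "n = Some l" for l
    using tag_okD[OF R(2) that] P(2) Q(2) FH fin by (auto simp: card_Un_disjoint)
  ultimately show ?thesis
    unfolding coloured_def card using R(1) by (intro bexI[of _ "(n, R)"]) auto
qed

lemma piece_coloured:
  "piece k c U F u v \<Longrightarrow> (\<And>p. card (incident_edges F p) \<le> 4) \<Longrightarrow> coloured k c F u v"
proof (induction rule: piece.induct)
  case (gap u v)
  show ?case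
    by (rule coloured_gap)
next
  case (close c U F u v)
  note facts = piece_facts[OF close.hyps]
  have "card (incident_edges F p) \<le> 4" for p
  proof -
    have "card (incident_edges F p) \<le> card (incident_edges (insert {u, v} F) p)"
      using facts by (intro card_mono) (auto simp: incident_edges_def)
    then show ?thesis
      using close.prems[of p] by linarith
  qed
  then show ?case
    using close.IH facts close.prems by (intro coloured_close) auto
next
  case (gap_series k W H w v u)
  note facts = piece_facts[OF gap_series.hyps(1)]
  have "coloured False (False \<and> True) ({} \<union> H) u v"
    using gap_series facts by (intro coloured_series[OF coloured_gap gap_series.IH]) auto
  then show ?case
    by simp
next
  case (closed_series U F u w k c W H v)
  note F = piece_facts[OF closed_series.hyps(1)] and H = piece_facts[OF closed_series.hyps(2)]
  have "card (incident_edges F p) \<le> 4" "card (incident_edges H p) \<le> 4" for p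
  proof -
    have "card (incident_edges F p) \<le> card (incident_edges (F \<union> H) p)"
      "card (incident_edges H p) \<le> card (incident_edges (F \<union> H) p)"
      using F H by (intro card_mono; auto simp: incident_edges_def)+
    then show "card (incident_edges F p) \<le> 4" "card (incident_edges H p) \<le> 4"
      using closed_series.prems[of p] by linarith+
  qed
  then have IH: "coloured True True F u w" "coloured k c H w v"
    using closed_series.IH by auto
  have "u \<notin> W" "v \<notin> U"
    using closed_series.hyps(3) F H by auto
  then have "u \<notin> \<Union> H" "v \<notin> \<Union> F" "\<Union> F \<inter> \<Union> H \<subseteq> {w}"
    using closed_series.hyps(3) F H by blast+
  then have "coloured False (True \<and> c) (F \<union> H) u v"
    using F H closed_series.prems by (intro coloured_series[OF IH]) auto
  then show ?case
    by simp
qed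

section \<open>Decomposition along a vertex order\<close>

locale one_page_graph =
  fixes V :: "'a set" and E :: "'a set set" and f :: "'a \<Rightarrow> nat"
  assumes finite_V: "finite V"
    and edges: "\<And>e. e \<in> E \<Longrightarrow> e \<subseteq> V \<and> card e = 2"
    and page: "one_page V E f"
    and no_closed_set: "\<And>X. X \<subseteq> V \<Longrightarrow> X \<noteq> {} \<Longrightarrow> X \<noteq> V \<Longrightarrow> \<exists>x\<in>X. \<exists>y\<in>V - X. {x, y} \<in> E"
begin

definition interval :: "'a \<Rightarrow> 'a \<Rightarrow> 'a set" where
  "interval u v = {x \<in> V. f u \<le> f x \<and> f x \<le> f v}"

definition interval_edges :: "'a \<Rightarrow> 'a \<Rightarrow> 'a set set" where
  "interval_edges u v = {e \<in> E. e \<subseteq> interval u v}"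

text \<open>Inner vertices of an isolated interval have no neighbours outside the interval.\<close>

definition isolated :: "'a \<Rightarrow> 'a \<Rightarrow> bool" where
  "isolated u v \<longleftrightarrow> (\<forall>x\<in>V. \<forall>y\<in>V - interval u v. f u < f x \<and> f x < f v \<longrightarrow> {x, y} \<notin> E)"

lemma isolatedD:
  "isolated u v \<Longrightarrow> x \<in> V \<Longrightarrow> y \<in> V \<Longrightarrow> f u < f x \<Longrightarrow> f x < f v \<Longrightarrow> {x, y} \<in> E \<Longrightarrow> y \<in> interval u v"
  unfolding isolated_def by blast

text \<open>In cut form: within the interval, \<open>u\<close> and \<open>v\<close> lie in different
  components. It is the evidence that goes with a disconnected piece.\<close>

definition separated :: "'a \<Rightarrow> 'a \<Rightarrow> bool" where
  "separated u v \<longleftrightarrow> (\<exists>X. u \<in> X \<and> v \<notin> X \<and> X \<subseteq> interval u v \<and>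
     (\<forall>x\<in>X. \<forall>y\<in>interval u v - X. {x, y} \<notin> E))"

lemma f_eq_iff: "x \<in> V \<Longrightarrow> y \<in> V \<Longrightarrow> f x = f y \<longleftrightarrow> x = y"
  using page unfolding one_page_def by (meson inj_on_eq_iff)

lemma no_crossing:
  assumes "{a, c} \<in> E" "{b, d} \<in> E" "f a < f b" "f b < f c" "f c < f d"
  shows False
  using assms edges[OF assms(1)] edges[OF assms(2)] by (intro one_pageD[OF page, of a b c d]) auto

lemma edgeE:
  assumes "e \<in> E"
  obtains x y where "e = {x, y}" "x \<in> V" "y \<in> V" "f x < f y"
proof -
  obtain x y where xy: "e = {x, y}" "x \<noteq> y"
    using edges[OF assms] by (metis card_2_iff)
  then have "x \<in> V" "y \<in> V"
    using edges[OF assms] by auto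
  moreover have "f x < f y \<or> f y < f x"
    using f_eq_iff[OF calculation] xy(2) by linarith
  ultimately show ?thesis
    using that[of x y] that[of y x] xy(1) by (auto simp: insert_commute)
qed

text \<open>A set \<open>Y\<close> cutting \<open>w\<close> from \<open>v\<close> would have no
  outgoing edge at all: isolation keeps its neighbours between \<open>u\<close> and
  \<open>v\<close>, only \<open>u\<close> precedes \<open>w\<close> there, and \<open>u\<close> has
  no inner neighbour. This gives the connected right part that \<open>piece.gap_series\<close>
  demands.\<close>

lemma not_separated_after_gap:
  assumes uv: "isolated u v" and w: "w \<in> V" "f u < f w" "f w < f v" "v \<in> V" "u \<in> V"
    and next_w: "\<And>x. x \<in> V \<Longrightarrow> f u < f x \<Longrightarrow> f w \<le> f x"
    and no_nbr: "\<And>x. x \<in> V \<Longrightarrow> f u < f x \<Longrightarrow> f x < f v \<Longrightarrow> {u, x} \<notin> E"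
  shows "\<not> separated w v"
proof
  assume "separated w v"
  then obtain Y where Y: "w \<in> Y" "v \<notin> Y" "Y \<subseteq> interval w v"
    "\<And>x y. x \<in> Y \<Longrightarrow> y \<in> interval w v - Y \<Longrightarrow> {x, y} \<notin> E"
    unfolding separated_def by blast
  have "Y \<subseteq> V" "Y \<noteq> {}" "Y \<noteq> V"
    using Y(1-3) w unfolding interval_def by auto
  then obtain x y where xy: "x \<in> Y" "y \<in> V - Y" "{x, y} \<in> E"
    using no_closed_set by blast
  have x: "x \<in> V" "f w \<le> f x" "f x < f v"
    using Y xy(1) w f_eq_iff[of x v] unfolding interval_def by (auto simp: less_le)
  have "y \<in> interval u v"
    using isolatedD[OF uv, of x y] x w(2) xy by auto
  moreover have "y \<notin> interval w v"
    using Y(4)[OF xy(1)] xy by blast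
  ultimately have "f u \<le> f y" "f y < f w"
    using w unfolding interval_def by auto
  then have "y = u"
    using next_w[of y] f_eq_iff[of y u] xy(2) w by force
  then show False
    using no_nbr[of x] x w xy(3) by (simp add: insert_commute)
qed

definition decomposed :: "'a \<Rightarrow> 'a \<Rightarrow> bool" where
  "decomposed u v \<longleftrightarrow> (\<exists>k c. piece k c (interval u v) (interval_edges u v) u v \<and> (\<not> c \<longrightarrow> separated u v))"

text \<open>The edge between \<open>u\<close> and \<open>v\<close> is set aside for
  \<open>piece.close\<close>. If \<open>u\<close> has no neighbour strictly inside, it is split off
  by a gap; otherwise the interval is cut at the last such neighbour.\<close>

lemma open_piece:
  assumes IH: "\<And>u' v'. f v' - f u' < f v - f u \<Longrightarrow> u' \<in> V \<Longrightarrow> v' \<in> V \<Longrightarrow> f u' < f v' \<Longrightarrow>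
      isolated u' v' \<Longrightarrow> decomposed u' v'"
    and uv: "u \<in> V" "v \<in> V" "f u < f v" "isolated u v"
  shows "\<exists>c. piece False c (interval u v) (interval_edges u v - {{u, v}}) u v \<and>
    (\<not> c \<longrightarrow> {u, v} \<notin> E \<longrightarrow> separated u v)"
proof -
  define N where "N = {x \<in> V. f u < f x \<and> f x < f v \<and> {u, x} \<in> E}"
  have finN: "finite N"
    unfolding N_def using finite_V by simp
  have uv_int: "u \<in> interval u v" "v \<in> interval u v"
    using uv unfolding interval_def by auto
  show ?thesis
  proof (cases "N = {}")
    case True
    \<comment> \<open>The successor of \<open>u\<close> in the order, possibly \<open>v\<close>
      itself.\<close>
    define w where "w = arg_min_on f {x \<in> V. f u < f x}"
    have fin: "finite {x \<in> V. f u < f x}" "{x \<in> V. f u < f x} \<noteq> {}"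
      using finite_V uv by auto
    have w: "w \<in> V" "f u < f w" and w_least: "\<And>x. x \<in> V \<Longrightarrow> f u < f x \<Longrightarrow> f w \<le> f x"
      using arg_min_if_finite[OF fin, of f] unfolding w_def by (auto simp: not_less)
    have no_nbr: "\<And>x. x \<in> V \<Longrightarrow> f u < f x \<Longrightarrow> f x < f v \<Longrightarrow> {u, x} \<notin> E"
      using True unfolding N_def by blast
    have sep: "separated u v" if "{u, v} \<notin> E"
    proof -
      have "{u, y} \<notin> E" if "y \<in> interval u v - {u}" for y
      proof (cases "y = v")
        case False
        then have "f u < f y" "f y < f v"
          using that f_eq_iff[of u y] f_eq_iff[of y v] uv unfolding interval_def by auto
        then show ?thesis
          using no_nbr that unfolding interval_def by blast
      qed (use \<open>{u, v} \<notin> E\<close> in simp)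
      then show ?thesis
        unfolding separated_def using uv uv_int by (intro exI[of _ "{u}"]) auto
    qed
    have int: "interval u v = insert u (interval w v)"
      using uv w w_least f_eq_iff[of u] unfolding interval_def by (force simp: le_less)
    have edges_eq: "interval_edges u v - {{u, v}} = interval_edges w v"
    proof -
      have u_notin: "u \<notin> interval w v"
        using w unfolding interval_def by auto
      have "e \<subseteq> interval w v" if e: "e \<in> E" "e \<subseteq> interval u v" "e \<noteq> {u, v}" for e
      proof -
        obtain x y where xy: "e = {x, y}" "x \<in> V" "y \<in> V" "f x < f y"
          using edgeE[OF e(1)] .
        have "y \<noteq> u"
          using xy e(2) unfolding interval_def by auto
        moreover have "x \<noteq> u"
        proof
          assume "x = u"
          then have "f y < f v"
            using xy e f_eq_iff[of y v] uv unfolding interval_def by (auto simp: less_le)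
          then show False
            using no_nbr[of y] xy e(1) \<open>x = u\<close> by simp
        qed
        ultimately show ?thesis
          using e(2) xy(1) unfolding int by auto
      qed
      then show ?thesis
        unfolding interval_edges_def int using u_notin by auto
    qed
    show ?thesis
    proof (cases "w = v")
      case True
      have "interval v v = {v}"
        using f_eq_iff[of v] uv unfolding interval_def by auto
      moreover have "interval_edges v v = {}"
      proof -
        have "\<not> e \<subseteq> {v}" if "e \<in> E" for e
          using edges[OF that] card_mono[of "{v}" e] by auto
        then show ?thesis
          unfolding interval_edges_def calculation by blast
      qed
      ultimately have "piece False False (interval u v) (interval_edges u v - {{u, v}}) u v"
        unfolding edges_eq int True using uv piece.gap[of u v] by auto
      then show ?thesis
        using sep by blast
    next
      case False
      have wv: "f w < f v"
        using w_least[of v] uv False f_eq_iff[of w v] w by fastforce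
      have iso: "isolated w v"
        unfolding isolated_def
      proof (intro ballI impI notI)
        fix x y assume xy: "x \<in> V" "y \<in> V - interval w v" "f w < f x \<and> f x < f v" "{x, y} \<in> E"
        have x: "f u < f x"
          using xy w by linarith
        have "y \<in> interval u v"
          using isolatedD[OF uv(4), of x y] xy x by auto
        then have "y = u"
          using xy(2) unfolding int by blast
        then show False
          using no_nbr[of x] x xy by (simp add: insert_commute)
      qed
      have "decomposed w v"
        using w uv wv iso by (intro IH) auto
      moreover have "\<not> separated w v"
        using uv w wv w_least no_nbr by (intro not_separated_after_gap[of u v w])
      ultimately obtain k where "piece k True (interval w v) (interval_edges w v) w v"
        unfolding decomposed_def by metis
      moreover have "u \<notin> interval w v"
        using w unfolding interval_def by auto
      ultimately have "piece False False (insert u (interval w v)) (interval_edges w v) u v"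
        by (rule piece.gap_series)
      then show ?thesis
        unfolding edges_eq int[symmetric] using sep by blast
    qed
  next
    case False
    have "Max (f ` N) \<in> f ` N"
      using finN False by (intro Max_in) auto
    then obtain w where w_Max: "w \<in> N" "Max (f ` N) = f w"
      by blast
    then have w_greatest: "\<And>x. x \<in> N \<Longrightarrow> f x \<le> f w"
      using finN Max_ge[of "f ` N"] by (metis finite_imageI imageI)
    have w: "w \<in> V" "f u < f w" "f w < f v" "{u, w} \<in> E"
      using w_Max(1) unfolding N_def by auto
    \<comment> \<open>An edge passing over \<open>w\<close> from a vertex behind \<open>u\<close>
      would cross the edge from \<open>u\<close> to \<open>w\<close>; one starting at
      \<open>u\<close> ends in \<open>v\<close> because \<open>w\<close> is the last inner
      neighbour.\<close>
    have cross: "x = u \<and> y = v" if "{x, y} \<in> E" "x \<in> V" "y \<in> V" "f u \<le> f x" "f x < f w" "f w < f y" "f y \<le> f v" for x y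
    proof -
      have "x = u"
      proof (rule ccontr)
        assume "x \<noteq> u"
        then have "f u < f x"
          using that f_eq_iff[of x u] uv by (simp add: less_le)
        then show False
          using no_crossing[OF w(4) that(1)] that by simp
      qed
      moreover have "y = v"
      proof (rule ccontr)
        assume "y \<noteq> v"
        then have "f y < f v"
          using that f_eq_iff[of y v] uv by (simp add: less_le)
        then have "y \<in> N"
          using that \<open>x = u\<close> w unfolding N_def by auto
        then show False
          using w_greatest[of y] that by simp
      qed
      ultimately show ?thesis ..
    qed
    have int: "interval u v = interval u w \<union> interval w v" "interval u w \<inter> interval w v = {w}"
      using w f_eq_iff[OF _ w(1)] unfolding interval_def by auto
    have edges_eq: "interval_edges u v - {{u, v}} = interval_edges u w \<union> interval_edges w v"
    proof -
      have "e \<subseteq> interval u w \<or> e \<subseteq> interval w v" if e: "e \<in> E" "e \<subseteq> interval u v" "e \<noteq> {u, v}" for e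
      proof -
        obtain x y where xy: "e = {x, y}" "x \<in> V" "y \<in> V" "f x < f y"
          using edgeE[OF e(1)] .
        have bounds: "f u \<le> f x" "f y \<le> f v"
          using e(2) xy(1) unfolding interval_def by auto
        then have "\<not> (f x < f w \<and> f w < f y)"
          using cross[of x y] xy e(1,3) by auto
        then have "f y \<le> f w \<or> f w \<le> f x"
          by linarith
        then show ?thesis
          using xy bounds unfolding interval_def by auto
      qed
      moreover have "\<not> {u, v} \<subseteq> interval u w" "\<not> {u, v} \<subseteq> interval w v"
        using w uv unfolding interval_def by auto
      ultimately show ?thesis
        unfolding interval_edges_def int(1) by blast
    qed
    have iso_uw: "isolated u w"
      unfolding isolated_def
    proof (intro ballI impI notI)
      fix x y assume xy: "x \<in> V" "y \<in> V - interval u w" "f u < f x \<and> f x < f w" "{x, y} \<in> E"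
      then have "y \<in> interval u v"
        using isolatedD[OF uv(4), of x y] w(2,3) by auto
      then have "f w < f y" "f y \<le> f v"
        using xy(2) unfolding interval_def by auto
      then have "x = u"
        using cross[of x y] xy by auto
      then show False
        using xy(3) by simp
    qed
    have iso_wv: "isolated w v"
      unfolding isolated_def
    proof (intro ballI impI notI)
      fix x y assume xy: "x \<in> V" "y \<in> V - interval w v" "f w < f x \<and> f x < f v" "{x, y} \<in> E"
      then have "y \<in> interval u v"
        using isolatedD[OF uv(4), of x y] w(2,3) by auto
      then have "f y < f w" "f u \<le> f y"
        using xy(2) unfolding interval_def by auto
      then have "x = v"
        using cross[of y x] xy by (auto simp: insert_commute)
      then show False
        using xy(3) by simp
    qed
    have "f w - f u < f v - f u" "f v - f w < f v - f u"
      using w by simp_all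
    then have "decomposed u w" "decomposed w v"
      using IH[OF _ uv(1) w(1,2) iso_uw] IH[OF _ w(1) uv(2) w(3) iso_wv] by simp_all
    then obtain k c k' c' where p: "piece k c (interval u w) (interval_edges u w) u w"
      "piece k' c' (interval w v) (interval_edges w v) w v" "\<not> c' \<longrightarrow> separated w v"
      unfolding decomposed_def by blast
    have "{u, w} \<in> interval_edges u w"
      using w uv unfolding interval_edges_def interval_def by auto
    \<comment> \<open>Since \<open>u\<close> and \<open>w\<close> are adjacent, the left part is a
      closed piece, as \<open>piece.closed_series\<close> requires.\<close>
    then have "k \<and> c"
      using piece_facts[OF p(1)] by blast
    then have "piece False c' (interval u v) (interval_edges u v - {{u, v}}) u v"
      unfolding int(1) edges_eq using p(1,2) int(2) piece.closed_series by simp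
    \<comment> \<open>The left part is connected to \<open>w\<close>, so it joins the side of
      \<open>w\<close> in the cut of the right part.\<close>
    moreover have "separated u v" if c': "\<not> c'" and "{u, v} \<notin> E"
    proof -
      obtain Y where Y: "w \<in> Y" "v \<notin> Y" "Y \<subseteq> interval w v"
        "\<And>x y. x \<in> Y \<Longrightarrow> y \<in> interval w v - Y \<Longrightarrow> {x, y} \<notin> E"
        using p(3) c' unfolding separated_def by blast
      let ?X = "interval u w \<union> Y"
      have "{x, y} \<notin> E" if xy: "x \<in> ?X" "y \<in> interval u v - ?X" for x y
      proof
        assume e: "{x, y} \<in> E"
        have y: "y \<in> interval w v - Y" "y \<notin> interval u w"
          using xy(2) unfolding int(1) by auto
        have "{x, y} \<in> interval_edges u v - {{u, v}}"
          using e xy Y(3) \<open>{u, v} \<notin> E\<close> unfolding interval_edges_def int(1) by auto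
        then have "x \<in> interval w v"
          using y(2) unfolding edges_eq by (auto simp: interval_edges_def)
        then have "x \<in> Y"
          using xy(1) int(2) Y(1) by (metis IntI UnE singletonD)
        then show False
          using Y(4)[OF _ y(1)] e by blast
      qed
      moreover have "u \<in> ?X" "v \<notin> ?X" "?X \<subseteq> interval u v"
        using uv w Y unfolding int(1) by (auto simp: interval_def)
      ultimately show ?thesis
        unfolding separated_def by blast
    qed
    ultimately show ?thesis
      by blast
  qed
qed

lemma interval_decomposed:
  "u \<in> V \<Longrightarrow> v \<in> V \<Longrightarrow> f u < f v \<Longrightarrow> isolated u v \<Longrightarrow> decomposed u v"
proof (induction "f v - f u" arbitrary: u v rule: less_induct)
  case less
  obtain c where c: "piece False c (interval u v) (interval_edges u v - {{u, v}}) u v"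
    "\<not> c \<longrightarrow> {u, v} \<notin> E \<longrightarrow> separated u v"
    using open_piece[of v u] less by blast
  show ?case
  proof (cases "{u, v} \<in> E")
    case True
    then have "{u, v} \<in> interval_edges u v"
      using less.prems unfolding interval_edges_def interval_def by auto
    then show ?thesis
      using piece.close[OF c(1)] unfolding decomposed_def by (auto simp: insert_absorb)
  next
    case False
    then have "interval_edges u v - {{u, v}} = interval_edges u v"
      unfolding interval_edges_def by blast
    then show ?thesis
      using c False unfolding decomposed_def by auto
  qed
qed

text \<open>The interval from the least to the greatest vertex is everything, hence isolated, and
  connectedness forbids a separation of its ends.\<close>

lemma graph_is_piece:
  assumes "card V \<ge> 2"
  shows "\<exists>k u v. piece k True V E u v"
proof -
  have "V \<noteq> {}"
    using assms by auto
  obtain u where u: "u \<in> V" "\<And>x. x \<in> V \<Longrightarrow> f u \<le> f x"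
    using Min_in[of "f ` V"] Min_le[of "f ` V"] finite_V \<open>V \<noteq> {}\<close>
    by (metis (no_types, lifting) finite_imageI image_iff image_is_empty imageI)
  obtain v where v: "v \<in> V" "\<And>x. x \<in> V \<Longrightarrow> f x \<le> f v"
    using Max_in[of "f ` V"] Max_ge[of "f ` V"] finite_V \<open>V \<noteq> {}\<close>
    by (metis (no_types, lifting) finite_imageI image_iff image_is_empty imageI)
  have "f u \<noteq> f v"
  proof
    assume "f u = f v"
    then have "x = u" if "x \<in> V" for x
      using u v that f_eq_iff[of x u] by (metis le_antisym)
    then have "V \<subseteq> {u}"
      by blast
    then show False
      using card_mono[of "{u}" V] assms by simp
  qed
  then have uv: "f u < f v"
    using u v by (simp add: less_le)
  have int: "interval u v = V"
    using u v unfolding interval_def by auto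
  have int_edges: "interval_edges u v = E"
    unfolding interval_edges_def int using edges by auto
  have "decomposed u v"
    using u v uv int by (intro interval_decomposed) (auto simp: isolated_def)
  moreover have "\<not> separated u v"
  proof
    assume "separated u v"
    then obtain X where "u \<in> X" "v \<notin> X" "X \<subseteq> V" "\<And>x y. x \<in> X \<Longrightarrow> y \<in> V - X \<Longrightarrow> {x, y} \<notin> E"
      unfolding separated_def int by blast
    then show False
      using no_closed_set[of X] v by blast
  qed
  ultimately show ?thesis
    unfolding decomposed_def int int_edges by metis
qed

end

section \<open>Cyclic interval colourings\<close>

lemma consecutive_atLeastAtMost: "A = {a..b} \<Longrightarrow> consecutive A"
  unfolding consecutive_def by blast

text \<open>A cyclic interval or its complement avoids the passage from 4 to 0; the 32 sets are
  checked one by one.\<close>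

lemma cyc_consecutive:
  assumes "cyc x"
  shows "consecutive (Suc ` col_set x) \<or> consecutive ({1..5} - Suc ` col_set x)"
proof -
  have sets: "{1..5} = {1, 2, 3, 4, 5::nat}"
    by auto
  have consecutive: "consecutive {}" "consecutive {1}" "consecutive {1, 2}"
    "consecutive {1, 2, 3}" "consecutive {1, 2, 3, 4}" "consecutive {1, 2, 3, 4, 5}"
    "consecutive {2}" "consecutive {2, 3}" "consecutive {2, 3, 4}" "consecutive {2, 3, 4, 5}"
    "consecutive {3}" "consecutive {3, 4}" "consecutive {3, 4, 5}" "consecutive {4}"
    "consecutive {4, 5}" "consecutive {5}"
    subgoal by (rule consecutive_atLeastAtMost[of _ 1 0]) auto
    subgoal by (rule consecutive_atLeastAtMost[of _ 1 1]) auto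
    subgoal by (rule consecutive_atLeastAtMost[of _ 1 2]) auto
    subgoal by (rule consecutive_atLeastAtMost[of _ 1 3]) auto
    subgoal by (rule consecutive_atLeastAtMost[of _ 1 4]) auto
    subgoal by (rule consecutive_atLeastAtMost[of _ 1 5]) auto
    subgoal by (rule consecutive_atLeastAtMost[of _ 2 2]) auto
    subgoal by (rule consecutive_atLeastAtMost[of _ 2 3]) auto
    subgoal by (rule consecutive_atLeastAtMost[of _ 2 4]) auto
    subgoal by (rule consecutive_atLeastAtMost[of _ 2 5]) auto
    subgoal by (rule consecutive_atLeastAtMost[of _ 3 3]) auto
    subgoal by (rule consecutive_atLeastAtMost[of _ 3 4]) auto
    subgoal by (rule consecutive_atLeastAtMost[of _ 3 5]) auto
    subgoal by (rule consecutive_atLeastAtMost[of _ 4 4]) auto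
    subgoal by (rule consecutive_atLeastAtMost[of _ 4 5]) auto
    subgoal by (rule consecutive_atLeastAtMost[of _ 5 5]) auto
    done
  obtain a b c d e where x: "x = (a, b, c, d, e)"
    by (cases x)
  show ?thesis
    using assms unfolding sets x
    by (cases a; cases b; cases c; cases d; cases e)
      (simp_all only: cyc.simps simp_thms col_set_if if_True if_False Un_empty_left Un_empty_right Un_insert_left
        image_insert image_empty, simp_all add: consecutive insert_Diff_if One_nat_def[symmetric] del: One_nat_def)
qed

lemma connected_graph_no_closed_set:
  assumes "simple_graph V E" "connected_graph V E" and X: "X \<subseteq> V" "X \<noteq> {}" "X \<noteq> V"
  shows "\<exists>x\<in>X. \<exists>y\<in>V - X. {x, y} \<in> E"
proof (rule ccontr)
  assume closed: "\<not> ?thesis"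
  obtain x y where xy: "x \<in> X" "y \<in> V" "y \<notin> X"
    using X by blast
  have "(x, y) \<in> {(x, y). {x, y} \<in> E}\<^sup>*"
    using assms(2) xy X(1) unfolding connected_graph_def by blast
  then have "y \<in> X"
  proof (induction rule: rtrancl_induct)
    case (step y z)
    then have "{y, z} \<in> E"
      by simp
    moreover have "z \<in> V"
      using assms(1) calculation unfolding simple_graph_def by blast
    ultimately show ?case
      using closed step.IH by blast
  qed (rule xy(1))
  then show False
    using xy(3) by blast
qed

text \<open>With three different colours properness is automatic, and \<open>{1, 3}\<close>, the
  only subset of \<open>{1, 2, 3}\<close> that is not consecutive, has the complement
  \<open>{2}\<close>.\<close>

lemma three_edges_cyclic:
  assumes "card E = 3"
  shows "\<exists>\<alpha>. cyclic_interval_coloring V E 3 \<alpha>"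
proof -
  have "finite E"
    using assms card.infinite by fastforce
  then obtain h where h: "bij_betw h E {0..<3::nat}"
    using ex_bij_betw_finite_nat[of E] assms by auto
  define \<alpha> where "\<alpha> e = Suc (h e)" for e
  have range: "\<alpha> e \<in> {1..3}" if "e \<in> E" for e
    using bij_betwE[OF h] that unfolding \<alpha>_def by fastforce
  have inj: "\<alpha> e \<noteq> \<alpha> e'" if "e \<in> E" "e' \<in> E" "e \<noteq> e'" for e e'
    using bij_betw_imp_inj_on[OF h] that unfolding \<alpha>_def by (auto dest: inj_onD)
  have three: "{1..3} = {1, 2, 3::nat}"
    by auto
  have "consecutive S \<or> consecutive ({1..3} - S)" if "S \<subseteq> {1..3}" for S :: "nat set"
  proof -
    have consec: "consecutive {}" "consecutive {1}" "consecutive {2}" "consecutive {3}"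
      "consecutive {1, 2}" "consecutive {2, 3}" "consecutive {1, 2, 3}"
      subgoal by (rule consecutive_atLeastAtMost[of _ 1 0]) auto
      subgoal by (rule consecutive_atLeastAtMost[of _ 1 1]) auto
      subgoal by (rule consecutive_atLeastAtMost[of _ 2 2]) auto
      subgoal by (rule consecutive_atLeastAtMost[of _ 3 3]) auto
      subgoal by (rule consecutive_atLeastAtMost[of _ 1 2]) auto
      subgoal by (rule consecutive_atLeastAtMost[of _ 2 3]) auto
      subgoal by (rule consecutive_atLeastAtMost[of _ 1 3]) auto
      done
    have "S \<in> Pow {1, 2, 3}"
      using that unfolding three by blast
    then consider "S = {}" | "S = {1}" | "S = {2}" | "S = {3}" | "S = {1, 2}" | "S = {2, 3}"
      | "S = {1, 3}" | "S = {1, 2, 3}"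
      unfolding Pow_insert Pow_empty by auto
    then show ?thesis
    proof cases
      case 7
      then have "{1..3} - S = {2}"
        unfolding three by auto
      then show ?thesis
        using consec by simp
    qed (use consec in simp_all)
  qed
  moreover have "spectrum E \<alpha> v \<subseteq> {1..3}" for v
    using range unfolding spectrum_def incident_edges_def by blast
  ultimately have "cyclic_interval_coloring V E 3 \<alpha>"
    unfolding cyclic_interval_coloring_def proper_edge_coloring_def using range inj by blast
  then show ?thesis
    by blast
qed

lemma realizable_cyclic:
  assumes "realizable E u v (x, y)" "cyc x" "cyc y"
  shows "\<exists>\<alpha>. cyclic_interval_coloring V E 5 \<alpha>"
proof -
  obtain \<alpha> where \<alpha>: "\<forall>e\<in>E. \<alpha> e < 5"
    "\<forall>e\<in>E. \<forall>e'\<in>E. e \<noteq> e' \<and> e \<inter> e' \<noteq> {} \<longrightarrow> \<alpha> e \<noteq> \<alpha> e'"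
    "\<forall>p\<in>\<Union> E - {u, v}. \<exists>z. cyc z \<and> spectrum E \<alpha> p = col_set z"
    "spectrum E \<alpha> u = col_set x" "spectrum E \<alpha> v = col_set y"
    using assms(1) unfolding realizable_def by auto
  have sp: "spectrum E (Suc \<circ> \<alpha>) p = Suc ` spectrum E \<alpha> p" for p
    unfolding spectrum_def by (simp add: image_comp)
  have "\<exists>z. cyc z \<and> spectrum E \<alpha> p = col_set z" for p
  proof -
    consider "p = u" | "p = v" | "p \<in> \<Union> E - {u, v}" | "p \<notin> \<Union> E"
      by blast
    then show ?thesis
    proof cases
      case 4
      then have "spectrum E \<alpha> p = col_set (cs [])"
        unfolding spectrum_def incident_edges_def col_set_empty by auto
      moreover have "cyc (cs [])"
        by code_simp
      ultimately show ?thesis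
        by blast
    qed (use \<alpha>(3-5) assms(2,3) in blast)+
  qed
  then have "consecutive (spectrum E (Suc \<circ> \<alpha>) p) \<or> consecutive ({1..5} - spectrum E (Suc \<circ> \<alpha>) p)" for p
    unfolding sp using cyc_consecutive by metis
  moreover have "(Suc \<circ> \<alpha>) e \<in> {1..5}" if "e \<in> E" for e
    using \<alpha>(1) that by (simp add: Suc_le_eq)
  moreover have "(Suc \<circ> \<alpha>) e \<noteq> (Suc \<circ> \<alpha>) e'" if "e \<in> E" "e' \<in> E" "e \<noteq> e'" "e \<inter> e' \<noteq> {}" for e e'
    using \<alpha>(2) that by simp
  ultimately have "cyclic_interval_coloring V E 5 (Suc \<circ> \<alpha>)"
    unfolding cyclic_interval_coloring_def proper_edge_coloring_def by blast
  then show ?thesis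
    by blast
qed

lemma piece_cyclic:
  assumes "piece k True V E u v" and deg: "\<And>p. card (incident_edges E p) \<le> 4"
  shows "\<exists>t::nat. t > 0 \<and> (\<exists>\<alpha>. cyclic_interval_coloring V E t \<alpha>)"
proof -
  let ?a = "card (incident_edges E u)" and ?b = "card (incident_edges E v)"
  obtain m R where R: "(m, R) \<in> set (relations k True ?a ?b)"
    "\<And>n. m = Some n \<Longrightarrow> card E = n" "\<And>xy. xy \<in> set R \<Longrightarrow> realizable E u v xy"
    using piece_coloured[OF assms] unfolding coloured_def by blast
  have le: "n \<in> set [0, 1, 2, 3, 4]" if "n \<le> 4" for n :: nat
    using that by auto
  have "k \<in> set [True, False]" "?a \<in> set [0, 1, 2, 3, 4]" "?b \<in> set [0, 1, 2, 3, 4]"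
    using le[OF deg] by auto
  then have "(k, ?a, ?b) \<in> set (List.product [True, False] (List.product [0, 1, 2, 3, 4] [0, 1, 2, 3, 4]))"
    unfolding set_product by (intro SigmaI)
  then have "final_ok (k, ?a, ?b)"
    using final_check[unfolded all_in_iff] by (rule bspec[rotated])
  then have "final_of (m, R)"
    using R(1) unfolding final_ok.simps all_in_iff by blast
  then consider "m = Some 3" | x y where "(x, y) \<in> set R" "cyc x" "cyc y"
    by (auto simp: some_in_iff split: if_splits)
  then show ?thesis
  proof cases
    case 1
    then show ?thesis
      using three_edges_cyclic R(2) by (intro exI[of _ 3]) auto
  next
    case 2
    then show ?thesis
      using realizable_cyclic[OF R(3)] by (intro exI[of _ 5] conjI) (simp, blast)
  qed
qed

lemma (in outer_drawing) theta_free_edges: "theta_free E"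
  unfolding theta_free_def
proof (intro allI impI notI)
  fix a b P Q R
  assume "distinct (a # b # P @ Q @ R) \<and> P \<noteq> [] \<and> Q \<noteq> [] \<and> R \<noteq> []"
    and "walk E (a # P @ [b]) \<and> walk E (a # Q @ [b]) \<and> walk E (a # R @ [b])"
  then show False
    by (intro no_theta[of a P b Q R]) auto
qed

lemma (in outer_drawing) chords_noncrossing_edges: "chords_noncrossing E"
  unfolding chords_noncrossing_def using no_crossing_chords by blast

theorem theorem5:
  fixes V :: "'a set" and E :: "'a set set"
  assumes "simple_graph V E"
    and "connected_graph V E"
    and "outerplanar V E"
    and "max_degree V E \<le> 4"
  shows "\<exists>t::nat. t > 0 \<and> (\<exists>\<alpha>. cyclic_interval_coloring V E t \<alpha>)"
proof -
  have V: "finite V" "V \<noteq> {}" and edges: "\<And>e. e \<in> E \<Longrightarrow> e \<subseteq> V \<and> card e = 2"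
    using assms(1) unfolding simple_graph_def by auto
  show ?thesis
  proof (cases "card V \<ge> 2")
    case True
    obtain p g where "planar_embedding V E p g" "\<And>v. v \<in> V \<Longrightarrow> p v \<in> frontier (outside (drawing V E p g))"
      using assms(3) unfolding outerplanar_def by blast
    then interpret outer_drawing V E p g
      using assms(1) by unfold_locales
    obtain f where f: "one_page V E f"
      using one_page_exists[OF V(1) theta_free_edges chords_noncrossing_edges] by blast
    interpret one_page_graph V E f
      using V(1) edges f connected_graph_no_closed_set[OF assms(1,2)] by unfold_locales
    obtain k u v where piece: "piece k True V E u v"
      using graph_is_piece[OF True] by blast
    have "card (incident_edges E q) \<le> 4" for q
    proof (cases "q \<in> V")
      case True
      then have "card (incident_edges E q) \<le> max_degree V E"
        unfolding max_degree_def using V(1) by (intro Max_ge) auto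
      then show ?thesis
        using assms(4) by simp
    next
      case False
      then have "incident_edges E q = {}"
        unfolding incident_edges_def using edges by blast
      then show ?thesis
        by simp
    qed
    then show ?thesis
      by (rule piece_cyclic[OF piece])
  next
    case False
    have "\<not> e \<in> E" for e
      using edges[of e] card_mono[OF V(1), of e] False by auto
    then have "E = {}"
      by blast
    then have "cyclic_interval_coloring V E 1 (\<lambda>_. 1)"
      using consecutive_atLeastAtMost[of "{}" 1 0]
      unfolding cyclic_interval_coloring_def proper_edge_coloring_def spectrum_def incident_edges_def by auto
    then show ?thesis
      by (intro exI[of _ 1]) auto
  qed
qed

end
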